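(* Let $\mathcal{Q}$ be a small quantaloid and $\mathbb{T}=(T,m,e)$ a monad on $\mathbf{Set}/\mathcal{Q}_0$. Let the monotone distributive law $\lambda$ of $\mathbb{T}$ over $\mathbb{P}_{\mathcal{Q}}$ and the lax extension $\hat{T}$ of $\mathbb{T}$ to $\mathcal{Q}\text{-}\mathbf{Rel}$ be related by $\overleftarrow{\hat{T}\varphi}=\lambda_X\cdot T\overleftarrow{\varphi}$ for all $\varphi\colon X\nrightarrow Y$ (equivalently, $\lambda_X=\overleftarrow{\hat{T}\varepsilon_X}$ for all $X$). Then there is a (natural) isomorphism of categories $$(\lambda,\mathcal{Q})\text{-}\mathbf{Alg}\cong(\mathbb{T},\hat{T},\mathcal{Q})\text{-}\mathbf{Cat}$$ which commutes with the underlying $\mathbf{Set}/\mathcal{Q}_0$-functors.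
   Context: A quantaloid is a category whose hom-sets are complete lattices and whose composition preserves arbitrary suprema in each variable. $\mathcal{Q}$ is a small quantaloid with object set $\mathcal{Q}_0$; $\bot$ denotes bottom elements. Objects of $\mathbf{Set}/\mathcal{Q}_0$ are sets $X$ with an array map $|\cdot|_X\colon X\to\mathcal{Q}_0$; morphisms are array-preserving maps. $\mathcal{Q}\text{-}\mathbf{Rel}$ has the same objects; a morphism ($\mathcal{Q}$-relation) $\varphi\colon X\nrightarrow Y$ is a family of $\mathcal{Q}$-morphisms $\varphi(x,y)\colon|x|\to|y|$, with $(\psi\circ\varphi)(x,z)=\bigvee_{y}\psi(y,z)\circ\varphi(x,y)$; hom-sets are ordered pointwise. For $f\colon X\to Y$ in $\mathbf{Set}/\mathcal{Q}_0$, $f^\circ\colon Y\nrightarrow X$ is given by $f^\circ(y,x)=1_{|x|}$ if $f(x)=y$ and $\bot$ otherwise; $1_X^\circ$ is the identity $\mathcal{Q}$-relation. Discrete presheaf monad $\mathbb{P}_{\mathcal{Q}}=(\mathsf{P},\mathsf{s},\mathsf{y})$ on $\mathbf{Set}/\mathcal{Q}_0$: $\mathsf{P}X$ is the set of all families $\sigma=(\sigma_x\colon|x|\to s)_{x\in X}$ of $\mathcal{Q}$-morphisms with a specified common codomain $s=:|\sigma|$ (the array of $\sigma$), ordered by $\sigma\le\sigma'$ iff $|\sigma|=|\sigma'|$ and $\sigma_x\le\sigma'_x$ for all $x$; maps into $\mathsf{P}X$ are ordered pointwise. $\mathsf{P}f=f_!$, $(f_!\sigma)_y=\bigvee_{x\in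 f^{-1}y}\sigma_x$; $(\mathsf{y}_Xy)_x=1_{|y|}$ if $x=y$, else $\bot$; $(\mathsf{s}_X\Sigma)_x=\bigvee_{\sigma\in\mathsf{P}X}\Sigma_\sigma\circ\sigma_x$. For $\varphi\colon X\nrightarrow Y$, $\overleftarrow{\varphi}\colon Y\to\mathsf{P}X$ is $(\overleftarrow{\varphi}(y))_x=\varphi(x,y)$. $\varepsilon_X\colon X\nrightarrow\mathsf{P}X$ is $\varepsilon_X(x,\sigma)=\sigma_x$. A monotone distributive law of $\mathbb{T}$ over $\mathbb{P}_{\mathcal{Q}}$ is a family of morphisms $\lambda_X\colon T\mathsf{P}X\to\mathsf{P}TX$ in $\mathbf{Set}/\mathcal{Q}_0$ such that for all $X$ and $f\colon X\to Y$: (a) $(Tf)_!\cdot\lambda_X\le\lambda_Y\cdot T(f_!)$; (b) $\mathsf{y}_{TX}\le\lambda_X\cdot T\mathsf{y}_X$; (c) $\mathsf{s}_{TX}\cdot(\lambda_X)_!\cdot\lambda_{\mathsf{P}X}\le\lambda_X\cdot T\mathsf{s}_X$; (d) $(e_X)_!\le\lambda_X\cdot e_{\mathsf{P}X}$; (e) $(m_X)_!\cdot\lambda_{TX}\cdot T\lambda_X\le\lambda_X\cdot m_{\mathsf{P}X}$; and $f\le g\Rightarrow\lambda_X\cdot Tf\le\lambda_X\cdot Tg$ for all $f,g\colon Y\to\mathsf{P}X$ in $\mathbf{Set}/\mathcal{Q}_0$. A lax extension $\hat{T}$ of $\mathbb{T}$ to $\mathcal{Q}\text{-}\mathbf{Rel}$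 is a family of $\mathcal{Q}$-relations $\hat{T}\varphi\colon TX\nrightarrow TY$ (one for each $\varphi\colon X\nrightarrow Y$), monotone in $\varphi$, such that for all $\varphi\colon X\nrightarrow Y$, $\psi\colon Y\nrightarrow Z$ and $h\colon Z\to Y$ in $\mathbf{Set}/\mathcal{Q}_0$: $\hat{T}(h^\circ\circ\varphi)=(Th)^\circ\circ\hat{T}\varphi$; $1_{TX}^\circ\le\hat{T}(1_X^\circ)$; $\hat{T}\psi\circ\hat{T}\varphi\le\hat{T}(\psi\circ\varphi)$; $\varphi\circ e_X^\circ\le e_Y^\circ\circ\hat{T}\varphi$; $\hat{T}\hat{T}\varphi\circ m_X^\circ\le m_Y^\circ\circ\hat{T}\varphi$. $(\lambda,\mathcal{Q})\text{-}\mathbf{Alg}$: objects (lax $\lambda$-algebras) are $(X,p)$ with $X\in\mathbf{Set}/\mathcal{Q}_0$ and $p\colon TX\to\mathsf{P}X$ in $\mathbf{Set}/\mathcal{Q}_0$ satisfying $\mathsf{y}_X\le p\cdot e_X$ and $\mathsf{s}_X\cdot p_!\cdot\lambda_X\cdot Tp\le p\cdot m_X$; morphisms $f\colon(X,p)\to(Y,q)$ (lax $\lambda$-homomorphisms) are $\mathbf{Set}/\mathcal{Q}_0$-morphisms with $f_!\cdot p\le q\cdot Tf$. $(\mathbb{T},\hat{T},\mathcal{Q})\text{-}\mathbf{Cat}$: objects are $(X,\alpha)$ with $X\in\mathbf{Set}/\mathcal{Q}_0$ and $\alpha\colon X\nrightarrow TX$ satisfying $1_X^\circ\le e_X^\circ\circ\alpha$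 and $\hat{T}\alpha\circ\alpha\le m_X^\circ\circ\alpha$; morphisms $f\colon(X,\alpha)\to(Y,\beta)$ are $\mathbf{Set}/\mathcal{Q}_0$-morphisms with $\alpha\circ f^\circ\le(Tf)^\circ\circ\beta$. *)

theory Defs
  imports "HOL-Library.FuncSet" "HOL-Algebra.Complete_Lattice"
begin

section \<open>A universe of sets\<close>

text \<open>The category of sets has to be closed under forming sets of functions, so its objects cannot
  range over the subsets of one fixed type. We work over a type whose elements are themselves sets,
  satisfying the (second-order) Zermelo--Fraenkel closure axioms; every Grothendieck universe is
  an instance. Foundation and infinity are not needed and not assumed. A \<open>set\<close> of the
  informal mathematics is a subset of this type that is the extension of one of its elements.\<close>

class set_universe =
  fixes elts :: "'a \<Rightarrow> 'a set"
  assumes elts_ext: "elts x = elts y \<Longrightarrow> x = y"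
    and elts_subset: "A \<subseteq> elts x \<Longrightarrow> A \<in> range elts"
    and elts_Union: "\<Union> (elts ` elts x) \<in> range elts"
    and elts_Pow: "{y. elts y \<subseteq> elts x} \<in> range elts"
    and elts_replacement: "f ` elts x \<in> range elts"

definition small :: "'v::set_universe set \<Rightarrow> bool"
  where "small A \<longleftrightarrow> A \<in> range elts"

definition vset :: "'v::set_universe set \<Rightarrow> 'v"
  where "vset A = (THE x. elts x = A)"

definition vpair :: "'v::set_universe \<Rightarrow> 'v \<Rightarrow> 'v"
  where "vpair a b = vset {vset {a}, vset {a, b}}"

definition vfst :: "'v::set_universe \<Rightarrow> 'v"
  where "vfst p = (THE a. \<exists>b. p = vpair a b)"

definition vsnd :: "'v::set_universe \<Rightarrow> 'v"
  where "vsnd p = (THE b. \<exists>a. p = vpair a b)"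

definition vgraph :: "'v::set_universe set \<Rightarrow> ('v \<Rightarrow> 'v) \<Rightarrow> 'v"
  where "vgraph A f = vset ((\<lambda>x. vpair x (f x)) ` A)"

definition vapp :: "'v::set_universe \<Rightarrow> 'v \<Rightarrow> 'v"
  where "vapp g x = (THE y. vpair x y \<in> elts g)"


section \<open>Categories, functors, monads\<close>

record ('o, 'a) cat_data =
  Ob :: "'o set"
  Hom :: "'o \<Rightarrow> 'o \<Rightarrow> 'a set"
  Id :: "'o \<Rightarrow> 'a"
  Comp :: "'a \<Rightarrow> 'a \<Rightarrow> 'a"  (infixl \<open>\<cdot>\<index>\<close> 70)

locale category =
  fixes C :: "('o, 'a, 'm) cat_data_scheme" (structure)
  assumes Hom_Ob: "f \<in> Hom C a b \<Longrightarrow> a \<in> Ob C \<and> b \<in> Ob C"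
    and Hom_disjoint: "f \<in> Hom C a b \<Longrightarrow> f \<in> Hom C a' b' \<Longrightarrow> a = a' \<and> b = b'"
    and Id_Hom: "a \<in> Ob C \<Longrightarrow> Id C a \<in> Hom C a a"
    and Comp_Hom: "f \<in> Hom C a b \<Longrightarrow> g \<in> Hom C b c \<Longrightarrow> g \<cdot> f \<in> Hom C a c"
    and Comp_Id: "f \<in> Hom C a b \<Longrightarrow> f \<cdot> Id C a = f"
    and Id_Comp: "f \<in> Hom C a b \<Longrightarrow> Id C b \<cdot> f = f"
    and Comp_assoc: "f \<in> Hom C a b \<Longrightarrow> g \<in> Hom C b c \<Longrightarrow> h \<in> Hom C c d \<Longrightarrow>
      h \<cdot> (g \<cdot> f) = (h \<cdot> g) \<cdot> f"

record ('o, 'a, 'p, 'b) functor_data =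
  omap :: "'o \<Rightarrow> 'p"
  amap :: "'a \<Rightarrow> 'b"

locale cat_functor = C: category C + D: category D
  for C :: "('o, 'a, 'm) cat_data_scheme"
    and D :: "('p, 'b, 'n) cat_data_scheme"
    and F :: "('o, 'a, 'p, 'b, 'k) functor_data_scheme" +
  assumes omap_Ob: "a \<in> Ob C \<Longrightarrow> omap F a \<in> Ob D"
    and amap_Hom: "f \<in> Hom C a b \<Longrightarrow> amap F f \<in> Hom D (omap F a) (omap F b)"
    and amap_Id: "a \<in> Ob C \<Longrightarrow> amap F (Id C a) = Id D (omap F a)"
    and amap_Comp: "f \<in> Hom C a b \<Longrightarrow> g \<in> Hom C b c \<Longrightarrow>
      amap F (g \<cdot>\<^bsub>C\<^esub> f) = amap F g \<cdot>\<^bsub>D\<^esub> amap F f"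

definition functor_id :: "('o, 'a, 'o, 'a) functor_data"
  where "functor_id = \<lparr>omap = \<lambda>a. a, amap = \<lambda>f. f\<rparr>"

definition functor_comp ::
    "('p, 'b, 'q, 'c) functor_data \<Rightarrow> ('o, 'a, 'p, 'b) functor_data \<Rightarrow> ('o, 'a, 'q, 'c) functor_data"
  where "functor_comp G F = \<lparr>omap = \<lambda>a. omap G (omap F a), amap = \<lambda>f. amap G (amap F f)\<rparr>"

text \<open>Equality of functors out of \<open>C\<close>, disregarding the values outside \<open>C\<close>.\<close>

definition functor_eq :: "('o, 'a, 'm) cat_data_scheme \<Rightarrow>
    ('o, 'a, 'p, 'b) functor_data \<Rightarrow> ('o, 'a, 'p, 'b) functor_data \<Rightarrow> bool"
  where "functor_eq C F G \<longleftrightarrow>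
    (\<forall>a\<in>Ob C. omap F a = omap G a) \<and>
    (\<forall>a\<in>Ob C. \<forall>b\<in>Ob C. \<forall>f\<in>Hom C a b. amap F f = amap G f)"

definition cat_isomorphism :: "('o, 'a, 'm) cat_data_scheme \<Rightarrow> ('p, 'b, 'n) cat_data_scheme \<Rightarrow>
    ('o, 'a, 'p, 'b) functor_data \<Rightarrow> bool"
  where "cat_isomorphism C D F \<longleftrightarrow> cat_functor C D F \<and>
    (\<exists>G. cat_functor D C G \<and>
      functor_eq C (functor_comp G F) functor_id \<and>
      functor_eq D (functor_comp F G) functor_id)"

record ('o, 'a) monad_data = "('o, 'a, 'o, 'a) functor_data" +
  mul :: "'o \<Rightarrow> 'a"
  unt :: "'o \<Rightarrow> 'a"

locale cat_monad = cat_functor C C T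
  for C :: "('o, 'a, 'm) cat_data_scheme" (structure)
    and T :: "('o, 'a) monad_data" +
  assumes unt_Hom: "a \<in> Ob C \<Longrightarrow> unt T a \<in> Hom C a (omap T a)"
    and mul_Hom: "a \<in> Ob C \<Longrightarrow> mul T a \<in> Hom C (omap T (omap T a)) (omap T a)"
    and unt_natural: "f \<in> Hom C a b \<Longrightarrow> amap T f \<cdot> unt T a = unt T b \<cdot> f"
    and mul_natural: "f \<in> Hom C a b \<Longrightarrow> amap T f \<cdot> mul T a = mul T b \<cdot> amap T (amap T f)"
    and mul_unt: "a \<in> Ob C \<Longrightarrow> mul T a \<cdot> unt T (omap T a) = Id C (omap T a)"
    and mul_map_unt: "a \<in> Ob C \<Longrightarrow> mul T a \<cdot> amap T (unt T a) = Id C (omap T a)"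
    and mul_assoc: "a \<in> Ob C \<Longrightarrow> mul T a \<cdot> mul T (omap T a) = mul T a \<cdot> amap T (mul T a)"


section \<open>Small quantaloids\<close>

record ('o, 'a) quantaloid_data = "('o, 'a) cat_data" +
  qle :: "'a \<Rightarrow> 'a \<Rightarrow> bool"

definition lat :: "('o, 'a, 'm) quantaloid_data_scheme \<Rightarrow> 'o \<Rightarrow> 'o \<Rightarrow> 'a gorder"
  where "lat Q a b = \<lparr>carrier = Hom Q a b, eq = (=), le = qle Q\<rparr>"

locale quantaloid = category Q
  for Q :: "('o, 'a, 'm) quantaloid_data_scheme" (structure) +
  assumes lat_complete: "a \<in> Ob Q \<Longrightarrow> b \<in> Ob Q \<Longrightarrow> complete_lattice (lat Q a b)"
    and Comp_Sup_right: "a \<in> Ob Q \<Longrightarrow> g \<in> Hom Q b c \<Longrightarrow> A \<subseteq> Hom Q a b \<Longrightarrow>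
      g \<cdot> (\<Squnion>\<^bsub>lat Q a b\<^esub> A) = \<Squnion>\<^bsub>lat Q a c\<^esub> ((\<lambda>f. g \<cdot> f) ` A)"
    and Comp_Sup_left: "c \<in> Ob Q \<Longrightarrow> f \<in> Hom Q a b \<Longrightarrow> B \<subseteq> Hom Q b c \<Longrightarrow>
      (\<Squnion>\<^bsub>lat Q b c\<^esub> B) \<cdot> f = \<Squnion>\<^bsub>lat Q a c\<^esub> ((\<lambda>g. g \<cdot> f) ` B)"

locale small_quantaloid = quantaloid Q
  for Q :: "('v::set_universe, 'v) quantaloid_data" +
  assumes small_Ob: "small (Ob Q)"
    and small_Hom: "a \<in> Ob Q \<Longrightarrow> b \<in> Ob Q \<Longrightarrow> small (Hom Q a b)"

type_synonym 'v qtld = "('v, 'v) quantaloid_data"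


section \<open>Sets over the objects of a quantaloid\<close>

text \<open>Arrows carry their source and target; functions and families are extensional (\<open>undefined\<close>
  outside the carrier), so that equality of the HOL objects is equality of the intended ones.\<close>

datatype ('o, 'm) arr = Arr (src: 'o) (tgt: 'o) (und: 'm)

record 'v aset = "'v partial_object" +
  array :: "'v \<Rightarrow> 'v"

type_synonym 'v smap = "('v aset, 'v \<Rightarrow> 'v) arr"

definition set_comp :: "'v smap \<Rightarrow> 'v smap \<Rightarrow> 'v smap"  (infixl \<open>\<odot>\<close> 70)
  where "g \<odot> f = Arr (src f) (tgt g) (compose (carrier (src f)) (und g) (und f))"

definition asets :: "'v::set_universe qtld \<Rightarrow> 'v aset set"
  where "asets Q = {X. small (carrier X) \<and> array X \<in> carrier X \<rightarrow>\<^sub>E Ob Q}"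

definition SetQ :: "'v::set_universe qtld \<Rightarrow> ('v aset, 'v smap) cat_data"
  where "SetQ Q = \<lparr>
    Ob = asets Q,
    Hom = \<lambda>X Y. {Arr X Y f | f. X \<in> asets Q \<and> Y \<in> asets Q \<and> f \<in> carrier X \<rightarrow>\<^sub>E carrier Y \<and>
      (\<forall>x\<in>carrier X. array Y (f x) = array X x)},
    Id = \<lambda>X. Arr X X (\<lambda>x\<in>carrier X. x),
    Comp = set_comp\<rparr>"


section \<open>Relations valued in a quantaloid\<close>

type_synonym 'v qrel = "('v aset, 'v \<times> 'v \<Rightarrow> 'v) arr"

definition rel_le :: "'v qtld \<Rightarrow> 'v qrel \<Rightarrow> 'v qrel \<Rightarrow> bool"
  where "rel_le Q \<phi> \<psi> \<longleftrightarrow>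
    (\<forall>x\<in>carrier (src \<phi>). \<forall>y\<in>carrier (tgt \<phi>). qle Q (und \<phi> (x, y)) (und \<psi> (x, y)))"

definition rel_comp :: "'v qtld \<Rightarrow> 'v qrel \<Rightarrow> 'v qrel \<Rightarrow> 'v qrel"
  where "rel_comp Q \<psi> \<phi> = Arr (src \<phi>) (tgt \<psi>)
    (\<lambda>(x, z)\<in>carrier (src \<phi>) \<times> carrier (tgt \<psi>).
      \<Squnion>\<^bsub>lat Q (array (src \<phi>) x) (array (tgt \<psi>) z)\<^esub>
        {und \<psi> (y, z) \<cdot>\<^bsub>Q\<^esub> und \<phi> (x, y) | y. y \<in> carrier (tgt \<phi>)})"

text \<open>The relation \<open>f\<degree>\<close> from \<open>Y\<close> to \<open>X\<close> for a map \<open>f\<close> from \<open>X\<close> to \<open>Y\<close>.\<close>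

definition circ :: "'v qtld \<Rightarrow> 'v smap \<Rightarrow> 'v qrel"
  where "circ Q f = Arr (tgt f) (src f)
    (\<lambda>(y, x)\<in>carrier (tgt f) \<times> carrier (src f).
      if und f x = y then Id Q (array (src f) x)
      else \<bottom>\<^bsub>lat Q (array (tgt f) y) (array (src f) x)\<^esub>)"

definition RelQ :: "'v::set_universe qtld \<Rightarrow> ('v aset, 'v qrel) cat_data"
  where "RelQ Q = \<lparr>
    Ob = asets Q,
    Hom = \<lambda>X Y. {Arr X Y \<phi> | \<phi>. X \<in> asets Q \<and> Y \<in> asets Q \<and>
      \<phi> \<in> (\<Pi>\<^sub>E (x, y)\<in>carrier X \<times> carrier Y. Hom Q (array X x) (array Y y))},
    Id = \<lambda>X. circ Q (Id (SetQ Q) X),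
    Comp = rel_comp Q\<rparr>"


section \<open>The discrete presheaf monad\<close>

text \<open>\<open>fam X s h\<close> is the element of the universe coding the family \<open>h\<close>, indexed by \<open>X\<close>, together
  with its specified codomain \<open>s\<close> (which \<open>h\<close> does not determine if \<open>X\<close> is empty).\<close>

definition fam :: "'v::set_universe aset \<Rightarrow> 'v \<Rightarrow> ('v \<Rightarrow> 'v) \<Rightarrow> 'v"
  where "fam X s h = vpair s (vgraph (carrier X) h)"

definition fcod :: "'v::set_universe \<Rightarrow> 'v"
  where "fcod \<sigma> = vfst \<sigma>"

definition fapp :: "'v::set_universe \<Rightarrow> 'v \<Rightarrow> 'v"
  where "fapp \<sigma> x = vapp (vsnd \<sigma>) x"

definition Psh :: "'v::set_universe qtld \<Rightarrow> 'v aset \<Rightarrow> 'v aset"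
  where "Psh Q X =
    (let S = {fam X s h | s h. s \<in> Ob Q \<and> (\<forall>x\<in>carrier X. h x \<in> Hom Q (array X x) s)}
     in \<lparr>carrier = S, array = (\<lambda>\<sigma>\<in>S. fcod \<sigma>)\<rparr>)"

definition Psh_le :: "'v::set_universe qtld \<Rightarrow> 'v aset \<Rightarrow> 'v \<Rightarrow> 'v \<Rightarrow> bool"
  where "Psh_le Q X \<sigma> \<tau> \<longleftrightarrow> fcod \<sigma> = fcod \<tau> \<and> (\<forall>x\<in>carrier X. qle Q (fapp \<sigma> x) (fapp \<tau> x))"

text \<open>The pointwise order on maps into \<open>Psh Q X\<close>.\<close>

definition map_le :: "'v::set_universe qtld \<Rightarrow> 'v aset \<Rightarrow> 'v smap \<Rightarrow> 'v smap \<Rightarrow> bool"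
  where "map_le Q X f g \<longleftrightarrow> (\<forall>y\<in>carrier (src f). Psh_le Q X (und f y) (und g y))"

definition Psh_map :: "'v::set_universe qtld \<Rightarrow> 'v smap \<Rightarrow> 'v smap"
  where "Psh_map Q f = Arr (Psh Q (src f)) (Psh Q (tgt f))
    (\<lambda>\<sigma>\<in>carrier (Psh Q (src f)). fam (tgt f) (fcod \<sigma>)
      (\<lambda>y. \<Squnion>\<^bsub>lat Q (array (tgt f) y) (fcod \<sigma>)\<^esub>
        {fapp \<sigma> x | x. x \<in> carrier (src f) \<and> und f x = y}))"

definition Psh_unit :: "'v::set_universe qtld \<Rightarrow> 'v aset \<Rightarrow> 'v smap"
  where "Psh_unit Q X = Arr X (Psh Q X)
    (\<lambda>y\<in>carrier X. fam X (array X y)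
      (\<lambda>x. if x = y then Id Q (array X y) else \<bottom>\<^bsub>lat Q (array X x) (array X y)\<^esub>))"

definition Psh_mult :: "'v::set_universe qtld \<Rightarrow> 'v aset \<Rightarrow> 'v smap"
  where "Psh_mult Q X = Arr (Psh Q (Psh Q X)) (Psh Q X)
    (\<lambda>\<Sigma>\<in>carrier (Psh Q (Psh Q X)). fam X (fcod \<Sigma>)
      (\<lambda>x. \<Squnion>\<^bsub>lat Q (array X x) (fcod \<Sigma>)\<^esub>
        {fapp \<Sigma> \<sigma> \<cdot>\<^bsub>Q\<^esub> fapp \<sigma> x | \<sigma>. \<sigma> \<in> carrier (Psh Q X)}))"

text \<open>\<open>larr Q \<phi>\<close> is \<open>\<phi>\<close> with a left-pointing arrow above it: the map from \<open>Y\<close> to \<open>Psh Q X\<close>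
  corresponding to the relation \<open>\<phi>\<close> from \<open>X\<close> to \<open>Y\<close>.\<close>

definition larr :: "'v::set_universe qtld \<Rightarrow> 'v qrel \<Rightarrow> 'v smap"
  where "larr Q \<phi> = Arr (tgt \<phi>) (Psh Q (src \<phi>))
    (\<lambda>y\<in>carrier (tgt \<phi>). fam (src \<phi>) (array (tgt \<phi>) y) (\<lambda>x. und \<phi> (x, y)))"

definition eps :: "'v::set_universe qtld \<Rightarrow> 'v aset \<Rightarrow> 'v qrel"
  where "eps Q X = Arr X (Psh Q X)
    (\<lambda>(x, \<sigma>)\<in>carrier X \<times> carrier (Psh Q X). fapp \<sigma> x)"


section \<open>Distributive laws and lax extensions\<close>

type_synonym 'v amonad = "('v aset, 'v smap) monad_data"

locale monotone_dist_law =
  fixes Q :: "'v::set_universe qtld"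
    and T :: "'v amonad"
    and lam :: "'v aset \<Rightarrow> 'v smap"
  assumes lam_Hom: "X \<in> Ob (SetQ Q) \<Longrightarrow>
      lam X \<in> Hom (SetQ Q) (omap T (Psh Q X)) (Psh Q (omap T X))"
    and lam_map: "f \<in> Hom (SetQ Q) X Y \<Longrightarrow>
      map_le Q (omap T Y) (Psh_map Q (amap T f) \<odot> lam X) (lam Y \<odot> amap T (Psh_map Q f))"
    and lam_Psh_unit: "X \<in> Ob (SetQ Q) \<Longrightarrow>
      map_le Q (omap T X) (Psh_unit Q (omap T X)) (lam X \<odot> amap T (Psh_unit Q X))"
    and lam_Psh_mult: "X \<in> Ob (SetQ Q) \<Longrightarrow>
      map_le Q (omap T X)
        (Psh_mult Q (omap T X) \<odot> Psh_map Q (lam X) \<odot> lam (Psh Q X))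
        (lam X \<odot> amap T (Psh_mult Q X))"
    and lam_unt: "X \<in> Ob (SetQ Q) \<Longrightarrow>
      map_le Q (omap T X) (Psh_map Q (unt T X)) (lam X \<odot> unt T (Psh Q X))"
    and lam_mul: "X \<in> Ob (SetQ Q) \<Longrightarrow>
      map_le Q (omap T X)
        (Psh_map Q (mul T X) \<odot> lam (omap T X) \<odot> amap T (lam X))
        (lam X \<odot> mul T (Psh Q X))"
    and lam_mono: "X \<in> Ob (SetQ Q) \<Longrightarrow>
      f \<in> Hom (SetQ Q) Y (Psh Q X) \<Longrightarrow> g \<in> Hom (SetQ Q) Y (Psh Q X) \<Longrightarrow> map_le Q X f g \<Longrightarrow>
      map_le Q (omap T X) (lam X \<odot> amap T f) (lam X \<odot> amap T g)"

locale lax_extension =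
  fixes Q :: "'v::set_universe qtld"
    and T :: "'v amonad"
    and That :: "'v qrel \<Rightarrow> 'v qrel"
  assumes That_Hom: "\<phi> \<in> Hom (RelQ Q) X Y \<Longrightarrow> That \<phi> \<in> Hom (RelQ Q) (omap T X) (omap T Y)"
    and That_mono: "\<phi> \<in> Hom (RelQ Q) X Y \<Longrightarrow> \<phi>' \<in> Hom (RelQ Q) X Y \<Longrightarrow> rel_le Q \<phi> \<phi>' \<Longrightarrow>
      rel_le Q (That \<phi>) (That \<phi>')"
    and That_circ: "\<phi> \<in> Hom (RelQ Q) X Y \<Longrightarrow> h \<in> Hom (SetQ Q) Z Y \<Longrightarrow>
      That (rel_comp Q (circ Q h) \<phi>) = rel_comp Q (circ Q (amap T h)) (That \<phi>)"
    and That_Id: "X \<in> Ob (SetQ Q) \<Longrightarrow>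
      rel_le Q (Id (RelQ Q) (omap T X)) (That (Id (RelQ Q) X))"
    and That_comp: "\<phi> \<in> Hom (RelQ Q) X Y \<Longrightarrow> \<psi> \<in> Hom (RelQ Q) Y Z \<Longrightarrow>
      rel_le Q (rel_comp Q (That \<psi>) (That \<phi>)) (That (rel_comp Q \<psi> \<phi>))"
    and That_unt: "\<phi> \<in> Hom (RelQ Q) X Y \<Longrightarrow>
      rel_le Q (rel_comp Q \<phi> (circ Q (unt T X))) (rel_comp Q (circ Q (unt T Y)) (That \<phi>))"
    and That_mul: "\<phi> \<in> Hom (RelQ Q) X Y \<Longrightarrow>
      rel_le Q (rel_comp Q (That (That \<phi>)) (circ Q (mul T X)))
        (rel_comp Q (circ Q (mul T Y)) (That \<phi>))"


section \<open>Lax algebras\<close>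

type_synonym 'v alg = "'v aset \<times> 'v smap"
type_synonym 'v rcat = "'v aset \<times> 'v qrel"

definition lax_algebras ::
    "'v::set_universe qtld \<Rightarrow> 'v amonad \<Rightarrow> ('v aset \<Rightarrow> 'v smap) \<Rightarrow> 'v alg set"
  where "lax_algebras Q T lam = {(X, p).
    X \<in> Ob (SetQ Q) \<and> p \<in> Hom (SetQ Q) (omap T X) (Psh Q X) \<and>
    map_le Q X (Psh_unit Q X) (p \<odot> unt T X) \<and>
    map_le Q X (Psh_mult Q X \<odot> Psh_map Q p \<odot> lam X \<odot> amap T p) (p \<odot> mul T X)}"

text \<open>In both categories below, an arrow \<open>Arr A B f\<close> has as \<open>f\<close> its underlying arrow of \<open>SetQ Q\<close>.\<close>

definition Alg :: "'v::set_universe qtld \<Rightarrow> 'v amonad \<Rightarrow> ('v aset \<Rightarrow> 'v smap) \<Rightarrow>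
    ('v alg, ('v alg, 'v smap) arr) cat_data"
  where "Alg Q T lam = \<lparr>
    Ob = lax_algebras Q T lam,
    Hom = \<lambda>A B. {Arr A B f | f. A \<in> lax_algebras Q T lam \<and> B \<in> lax_algebras Q T lam \<and>
      f \<in> Hom (SetQ Q) (fst A) (fst B) \<and>
      map_le Q (fst B) (Psh_map Q f \<odot> snd A) (snd B \<odot> amap T f)},
    Id = \<lambda>A. Arr A A (Id (SetQ Q) (fst A)),
    Comp = \<lambda>g f. Arr (src f) (tgt g) (und g \<odot> und f)\<rparr>"

definition rel_categories ::
    "'v::set_universe qtld \<Rightarrow> 'v amonad \<Rightarrow> ('v qrel \<Rightarrow> 'v qrel) \<Rightarrow> 'v rcat set"
  where "rel_categories Q T That = {(X, \<alpha>).
    X \<in> Ob (SetQ Q) \<and> \<alpha> \<in> Hom (RelQ Q) X (omap T X) \<and>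
    rel_le Q (Id (RelQ Q) X) (rel_comp Q (circ Q (unt T X)) \<alpha>) \<and>
    rel_le Q (rel_comp Q (That \<alpha>) \<alpha>) (rel_comp Q (circ Q (mul T X)) \<alpha>)}"

definition RCat :: "'v::set_universe qtld \<Rightarrow> 'v amonad \<Rightarrow> ('v qrel \<Rightarrow> 'v qrel) \<Rightarrow>
    ('v rcat, ('v rcat, 'v smap) arr) cat_data"
  where "RCat Q T That = \<lparr>
    Ob = rel_categories Q T That,
    Hom = \<lambda>A B. {Arr A B f | f. A \<in> rel_categories Q T That \<and> B \<in> rel_categories Q T That \<and>
      f \<in> Hom (SetQ Q) (fst A) (fst B) \<and>
      rel_le Q (rel_comp Q (snd A) (circ Q f)) (rel_comp Q (circ Q (amap T f)) (snd B))},
    Id = \<lambda>A. Arr A A (Id (SetQ Q) (fst A)),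
    Comp = \<lambda>g f. Arr (src f) (tgt g) (und g \<odot> und f)\<rparr>"

text \<open>The underlying functor to \<open>SetQ Q\<close>, for \<open>Alg\<close> as well as for \<open>RCat\<close>.\<close>

definition underlying :: "('v aset \<times> 's, ('v aset \<times> 's, 'v smap) arr, 'v aset, 'v smap) functor_data"
  where "underlying = \<lparr>omap = fst, amap = und\<rparr>"

end

theory Submission
  imports Defs
begin

text \<open>A relation from \<open>X\<close> to \<open>Y\<close> and a map from \<open>Y\<close> to \<open>Psh Q X\<close> are the same data, with the same
  order: \<open>larr Q\<close> is an isomorphism of ordered sets whose inverse reads a map as a matrix
  (\<open>larr_rel_of\<close>, \<open>rel_of_larr\<close>, \<open>map_le_larr_iff\<close>). Under this isomorphism the calculus of
  relations becomes the Kleisli calculus of the presheaf monad: the identity relation corresponds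
  to the unit (\<open>larr_Id\<close>), composition to Kleisli composition (\<open>larr_rel_comp\<close>), and composing with
  \<open>f\<degree>\<close> on either side to pushing forward or restricting along \<open>f\<close> (\<open>larr_comp_circ\<close>,
  \<open>larr_circ_comp\<close>).

  Hence every inequality between maps into presheaves that defines lax algebras and their
  homomorphisms is the \<open>larr\<close>-image of the inequality between relations that defines relational
  categories and their functors. The one place where \<open>lam\<close> meets \<open>That\<close> is the multiplication
  axiom: there the composite of \<open>lam X\<close> with \<open>amap T p\<close>, for \<open>p\<close> the map of \<open>\<alpha>\<close>, is the map of
  \<open>That \<alpha>\<close> because the two are related. So replacing \<open>p\<close> by the relation it encodes, while keeping
  underlying maps, is an isomorphism of categories.

  That the relatedness can be tested on \<open>eps Q X\<close> alone is a Yoneda argument: \<open>eps Q X\<close> corresponds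
  to the identity of \<open>Psh Q X\<close>, and every relation out of \<open>X\<close> is a restriction of it.\<close>

section \<open>Closure properties of the universe\<close>

lemma elts_vset: "elts (vset A) = A" if "small A"
proof -
  obtain x where "A = elts x"
    using \<open>small A\<close> by (auto simp: small_def)
  then have "(THE x. elts x = A) = x"
    by (auto intro: elts_ext)
  with \<open>A = elts x\<close> show ?thesis
    by (simp add: vset_def)
qed

lemma vset_eq_iff: "vset A = vset B \<longleftrightarrow> A = B" if "small A" "small B"
  using that elts_vset by metis

lemma small_subset: "small B" if "small A" "B \<subseteq> A"
  using that elts_subset by (auto simp: small_def)

lemma small_image: "small (f ` A)" if "small A" for f :: "'v::set_universe \<Rightarrow> 'v"
  using that elts_replacement by (auto simp: small_def)

lemma small_Union: "small (\<Union>a\<in>A. F a)" if "small A" "\<And>a. a \<in> A \<Longrightarrow> small (F a)"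
  for F :: "'v::set_universe \<Rightarrow> 'v set"
proof -
  have "small ((\<lambda>a. vset (F a)) ` A)"
    using \<open>small A\<close> by (rule small_image)
  then obtain x where x: "elts x = (\<lambda>a. vset (F a)) ` A"
    by (auto simp: small_def)
  have "\<Union> (elts ` elts x) = (\<Union>a\<in>A. F a)"
    using that(2) by (auto simp: x elts_vset)
  then show ?thesis
    using elts_Union[of x] by (simp add: small_def)
qed

lemma small_Pow: "small {y. elts y \<subseteq> A}" if "small A"
  using that elts_Pow by (auto simp: small_def)

text \<open>The power set of the power set of the empty set has two elements, so replacement turns it
  into any given unordered pair.\<close>

lemma small_doubleton: "small {a, b :: 'v::set_universe}"
proof -
  have empty: "small ({} :: 'v set)"
    using small_subset[of "elts undefined" "{}"] by (simp add: small_def)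
  define o0 :: 'v where "o0 = vset {}"
  have o0: "elts o0 = {}"
    using empty by (simp add: o0_def elts_vset)
  have "{y :: 'v. elts y \<subseteq> {}} = {o0}"
    using o0 by (auto intro: elts_ext)
  then have single: "small {o0}"
    using small_Pow[OF empty] by simp
  have "elts (vset {o0}) = {o0}"
    using single by (rule elts_vset)
  then have "{o0, vset {o0}} \<subseteq> {y. elts y \<subseteq> {o0}}" and ne: "o0 \<noteq> vset {o0}"
    using o0 by auto
  then have "small {o0, vset {o0}}"
    using small_Pow[OF single] small_subset by blast
  then have "small ((\<lambda>x. if x = o0 then a else b) ` {o0, vset {o0}})"
    by (rule small_image)
  then show ?thesis
    using ne by (simp add: insert_commute split: if_splits)
qed

lemma small_singleton: "small {a}"
  using small_doubleton[of a a] by simp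

lemma vpair_eq_iff: "vpair a b = vpair c d \<longleftrightarrow> a = c \<and> b = d"
  by (auto simp: vpair_def vset_eq_iff small_doubleton small_singleton doubleton_eq_iff)

lemma vfst_vpair [simp]: "vfst (vpair a b) = a"
  by (simp add: vfst_def vpair_eq_iff)

lemma vsnd_vpair [simp]: "vsnd (vpair a b) = b"
  by (simp add: vsnd_def vpair_eq_iff)

lemma elts_vgraph: "elts (vgraph A f) = (\<lambda>x. vpair x (f x)) ` A" if "small A"
  using that by (simp add: vgraph_def elts_vset small_image)

lemma vapp_vgraph: "vapp (vgraph A f) x = f x" if "small A" "x \<in> A"
  using that by (auto simp: vapp_def elts_vgraph vpair_eq_iff)

lemma vgraph_cong: "vgraph A f = vgraph A g" if "\<And>x. x \<in> A \<Longrightarrow> f x = g x"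
  using that by (auto simp: vgraph_def intro!: arg_cong[where f = vset] image_cong)

lemma small_vgraphs: "small {vgraph A h | h. \<forall>x\<in>A. h x \<in> B x}"
  if "small A" "\<And>x. x \<in> A \<Longrightarrow> small (B x)"
proof (rule small_subset)
  show "small {y. elts y \<subseteq> (\<Union>x\<in>A. (\<lambda>b. vpair x b) ` B x)}"
    using that by (intro small_Pow small_Union small_image)
  show "{vgraph A h | h. \<forall>x\<in>A. h x \<in> B x} \<subseteq> {y. elts y \<subseteq> (\<Union>x\<in>A. (\<lambda>b. vpair x b) ` B x)}"
    using \<open>small A\<close> by (fastforce simp: elts_vgraph)
qed

lemma fcod_fam [simp]: "fcod (fam X s h) = s"
  by (simp add: fcod_def fam_def)

lemma fapp_fam: "fapp (fam X s h) x = h x" if "small (carrier X)" "x \<in> carrier X"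
  using that by (simp add: fapp_def fam_def vapp_vgraph)

lemma fam_cong: "fam X s h = fam X s k" if "\<And>x. x \<in> carrier X \<Longrightarrow> h x = k x"
  using that vgraph_cong by (metis fam_def)


section \<open>Suprema in the hom-sets of a quantaloid\<close>

context quantaloid
begin

lemma hom_lattice: "complete_lattice (lat Q a b)" if "f \<in> Hom Q a b"
  using that Hom_Ob lat_complete by blast

lemma carrier_lat [simp]: "carrier (lat Q a b) = Hom Q a b"
  by (simp add: lat_def)

lemma le_lat [simp]: "le (lat Q a b) = qle Q"
  by (simp add: lat_def)

lemma qle_refl: "qle Q f f" if "f \<in> Hom Q a b"
proof -
  interpret L: complete_lattice "lat Q a b" using that by (rule hom_lattice)
  show ?thesis using L.le_refl[of f] that by simp
qed

lemma qle_trans: "qle Q f h"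
  if "qle Q f g" "qle Q g h" "f \<in> Hom Q a b" "g \<in> Hom Q a b" "h \<in> Hom Q a b"
proof -
  interpret L: complete_lattice "lat Q a b" using that(3) by (rule hom_lattice)
  show ?thesis using L.le_trans[of f g h] that by simp
qed

lemma qle_antisym: "f = g"
  if "qle Q f g" "qle Q g f" "f \<in> Hom Q a b" "g \<in> Hom Q a b"
proof -
  interpret L: complete_lattice "lat Q a b" using that(3) by (rule hom_lattice)
  show ?thesis using L.le_antisym[of f g] that by simp
qed

text \<open>Suprema are only known through their upper bounds, so equations between composites of suprema
  are proved by comparing upper bounds.\<close>

lemma hom_eqI: "f = g"
  if "f \<in> Hom Q a b" "g \<in> Hom Q a b" "\<And>u. u \<in> Hom Q a b \<Longrightarrow> qle Q f u \<longleftrightarrow> qle Q g u"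
  using that qle_antisym qle_refl by blast

lemma Sup_Hom: "\<Squnion>\<^bsub>lat Q a b\<^esub> A \<in> Hom Q a b"
  if "a \<in> Ob Q" "b \<in> Ob Q" "A \<subseteq> Hom Q a b"
proof -
  interpret L: complete_lattice "lat Q a b" using that by (intro lat_complete)
  show ?thesis using L.sup_closed[of A] that by simp
qed

lemma Sup_le_iff: "qle Q (\<Squnion>\<^bsub>lat Q a b\<^esub> A) u \<longleftrightarrow> (\<forall>f\<in>A. qle Q f u)"
  if A: "A \<subseteq> Hom Q a b" and u: "u \<in> Hom Q a b"
proof -
  interpret L: complete_lattice "lat Q a b" using u by (rule hom_lattice)
  have S: "\<Squnion>\<^bsub>lat Q a b\<^esub> A \<in> Hom Q a b"
    using A Hom_Ob[OF u] Sup_Hom by blast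
  have upper: "qle Q f (\<Squnion>\<^bsub>lat Q a b\<^esub> A)" if "f \<in> A" for f
    using L.sup_upper[of A f] A that by simp
  show ?thesis
    using L.sup_least[of A u] upper qle_trans[OF _ _ _ S u] A u by (auto simp: Upper_def)
qed

lemma bottom_Hom: "\<bottom>\<^bsub>lat Q a b\<^esub> \<in> Hom Q a b" if "a \<in> Ob Q" "b \<in> Ob Q"
proof -
  interpret L: complete_lattice "lat Q a b" using that by (intro lat_complete)
  show ?thesis using L.bottom_closed by simp
qed

lemma bottom_le: "qle Q (\<bottom>\<^bsub>lat Q a b\<^esub>) f" if "f \<in> Hom Q a b"
proof -
  interpret L: complete_lattice "lat Q a b" using that by (rule hom_lattice)
  show ?thesis using L.bottom_lower[of f] that by simp
qed

lemma Sup_empty_eq_bottom: "\<Squnion>\<^bsub>lat Q a b\<^esub> {} = \<bottom>\<^bsub>lat Q a b\<^esub>" if "a \<in> Ob Q" "b \<in> Ob Q"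
  using that by (intro hom_eqI[where a = a and b = b]) (auto simp: Sup_le_iff bottom_le Sup_Hom bottom_Hom)

lemma Comp_Sup_right_le_iff:
  "qle Q (g \<cdot> (\<Squnion>\<^bsub>lat Q a b\<^esub> A)) u \<longleftrightarrow> (\<forall>f\<in>A. qle Q (g \<cdot> f) u)"
  if "g \<in> Hom Q b c" "A \<subseteq> Hom Q a b" "u \<in> Hom Q a c"
proof -
  have "(\<lambda>f. g \<cdot> f) ` A \<subseteq> Hom Q a c"
    using that Comp_Hom by blast
  then show ?thesis
    using that Hom_Ob[OF that(3)] by (subst Comp_Sup_right) (auto simp: Sup_le_iff)
qed

lemma Comp_Sup_left_le_iff:
  "qle Q ((\<Squnion>\<^bsub>lat Q b c\<^esub> B) \<cdot> f) u \<longleftrightarrow> (\<forall>g\<in>B. qle Q (g \<cdot> f) u)"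
  if "f \<in> Hom Q a b" "B \<subseteq> Hom Q b c" "u \<in> Hom Q a c"
proof -
  have "(\<lambda>g. g \<cdot> f) ` B \<subseteq> Hom Q a c"
    using that Comp_Hom by blast
  then show ?thesis
    using that Hom_Ob[OF that(3)] by (subst Comp_Sup_left) (auto simp: Sup_le_iff)
qed

lemma Comp_bottom_le: "qle Q (g \<cdot> (\<bottom>\<^bsub>lat Q a b\<^esub>)) u" if "g \<in> Hom Q b c" "u \<in> Hom Q a c"
  using Comp_Sup_right_le_iff[OF that(1) _ that(2), of "{}"] Hom_Ob[OF that(1)] Hom_Ob[OF that(2)]
  by (simp add: Sup_empty_eq_bottom)

lemma bottom_Comp_le: "qle Q ((\<bottom>\<^bsub>lat Q b c\<^esub>) \<cdot> f) u" if "f \<in> Hom Q a b" "u \<in> Hom Q a c"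
  using Comp_Sup_left_le_iff[OF that(1) _ that(2), of "{}"] Hom_Ob[OF that(1)] Hom_Ob[OF that(2)]
  by (simp add: Sup_empty_eq_bottom)

end


section \<open>Relations and maps into presheaves\<close>

lemma Ob_SetQ [simp]: "Ob (SetQ Q) = asets Q"
  by (simp add: SetQ_def)

lemma Comp_SetQ [simp]: "Comp (SetQ Q) g f = g \<odot> f"
  by (simp add: SetQ_def)

lemma Hom_SetQ_iff: "f \<in> Hom (SetQ Q) X Y \<longleftrightarrow>
    src f = X \<and> tgt f = Y \<and> X \<in> asets Q \<and> Y \<in> asets Q \<and> und f \<in> carrier X \<rightarrow>\<^sub>E carrier Y \<and>
    (\<forall>x\<in>carrier X. array Y (und f x) = array X x)"
  by (cases f) (auto simp: SetQ_def)

lemma Hom_RelQ_iff: "\<phi> \<in> Hom (RelQ Q) X Y \<longleftrightarrow>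
    src \<phi> = X \<and> tgt \<phi> = Y \<and> X \<in> asets Q \<and> Y \<in> asets Q \<and>
    und \<phi> \<in> extensional (carrier X \<times> carrier Y) \<and>
    (\<forall>x\<in>carrier X. \<forall>y\<in>carrier Y. und \<phi> (x, y) \<in> Hom Q (array X x) (array Y y))"
  by (cases \<phi>) (auto simp: RelQ_def PiE_iff)

lemma asets_carrier_small: "X \<in> asets Q \<Longrightarrow> small (carrier X)"
  by (simp add: asets_def)

lemma asets_array: "X \<in> asets Q \<Longrightarrow> x \<in> carrier X \<Longrightarrow> array X x \<in> Ob Q"
  by (auto simp: asets_def)

lemma set_comp_apply: "x \<in> carrier (src f) \<Longrightarrow> und (g \<odot> f) x = und g (und f x)"
  by (simp add: set_comp_def compose_eq)

lemma src_set_comp [simp]: "src (g \<odot> f) = src f"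
  by (simp add: set_comp_def)

lemma arr_eqI: "src f = src g \<Longrightarrow> tgt f = tgt g \<Longrightarrow> und f = und g \<Longrightarrow> f = g"
  by (rule arr.expand) simp

lemma SetQ_eqI: "f = g"
  if "f \<in> Hom (SetQ Q) X Y" "g \<in> Hom (SetQ Q) X Y" "\<And>x. x \<in> carrier X \<Longrightarrow> und f x = und g x"
  using that by (intro arr_eqI) (auto simp: Hom_SetQ_iff intro: PiE_ext)

lemma RelQ_eqI: "\<phi> = \<psi>"
  if "\<phi> \<in> Hom (RelQ Q) X Y" "\<psi> \<in> Hom (RelQ Q) X Y"
    "\<And>x y. x \<in> carrier X \<Longrightarrow> y \<in> carrier Y \<Longrightarrow> und \<phi> (x, y) = und \<psi> (x, y)"
  using that by (intro arr_eqI) (auto simp: Hom_RelQ_iff intro: extensionalityI)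

text \<open>The relation from \<open>X\<close> corresponding to a map \<open>p\<close> into \<open>Psh Q X\<close>. Its source is an explicit
  argument because it cannot be read off from the set of presheaves that is the target of \<open>p\<close>.\<close>

definition rel_of :: "'v::set_universe aset \<Rightarrow> 'v smap \<Rightarrow> 'v qrel"
  where "rel_of X p = Arr X (src p) (\<lambda>(x, y)\<in>carrier X \<times> carrier (src p). fapp (und p y) x)"

context small_quantaloid
begin

lemma Psh_memD:
  assumes "\<sigma> \<in> carrier (Psh Q X)" "X \<in> asets Q"
  shows "fcod \<sigma> \<in> Ob Q" "array (Psh Q X) \<sigma> = fcod \<sigma>"
    "\<And>x. x \<in> carrier X \<Longrightarrow> fapp \<sigma> x \<in> Hom Q (array X x) (fcod \<sigma>)"
    "fam X (fcod \<sigma>) (fapp \<sigma>) = \<sigma>"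
proof -
  obtain s h where \<sigma>: "\<sigma> = fam X s h" "s \<in> Ob Q" "\<forall>x\<in>carrier X. h x \<in> Hom Q (array X x) s"
    using assms(1) by (auto simp: Psh_def Let_def)
  show "fcod \<sigma> \<in> Ob Q" "array (Psh Q X) \<sigma> = fcod \<sigma>"
    using \<sigma> assms(1) by (auto simp: Psh_def Let_def)
  show "\<And>x. x \<in> carrier X \<Longrightarrow> fapp \<sigma> x \<in> Hom Q (array X x) (fcod \<sigma>)"
    using \<sigma> assms(2) by (simp add: fapp_fam asets_carrier_small)
  show "fam X (fcod \<sigma>) (fapp \<sigma>) = \<sigma>"
    using \<sigma> assms(2) by (auto simp: fapp_fam asets_carrier_small intro: fam_cong)
qed

lemma Psh_eqI: "\<sigma> = \<tau>"
  if "\<sigma> \<in> carrier (Psh Q X)" "\<tau> \<in> carrier (Psh Q X)" "X \<in> asets Q" "fcod \<sigma> = fcod \<tau>"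
    "\<And>x. x \<in> carrier X \<Longrightarrow> fapp \<sigma> x = fapp \<tau> x"
  using that Psh_memD(4) fam_cong by metis

lemma fam_mem_Psh: "fam X s h \<in> carrier (Psh Q X)"
  if "s \<in> Ob Q" "\<And>x. x \<in> carrier X \<Longrightarrow> h x \<in> Hom Q (array X x) s"
  using that by (auto simp: Psh_def Let_def)

text \<open>Presheaves on a set again form a set, because a presheaf is coded by a codomain and a graph
  and both range over small sets. Without this neither \<open>T\<close> nor \<open>That\<close> could be applied to data on
  \<open>Psh Q X\<close>.\<close>

lemma Psh_in_asets: "Psh Q X \<in> asets Q" if "X \<in> asets Q"
proof -
  have "carrier (Psh Q X) =
      (\<Union>s\<in>Ob Q. vpair s ` {vgraph (carrier X) h | h. \<forall>x\<in>carrier X. h x \<in> Hom Q (array X x) s})"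
    by (auto simp: Psh_def Let_def fam_def)
  also have "small \<dots>"
    using that by (intro small_Union small_image small_vgraphs small_Ob small_Hom)
      (auto simp: asets_carrier_small asets_array)
  finally have "small (carrier (Psh Q X))" .
  moreover have "array (Psh Q X) \<in> carrier (Psh Q X) \<rightarrow>\<^sub>E Ob Q"
    by (auto simp: Psh_def Let_def)
  ultimately show ?thesis
    by (simp add: asets_def)
qed

lemma larr_apply:
  assumes "\<phi> \<in> Hom (RelQ Q) X Y" "y \<in> carrier Y"
  shows "fcod (und (larr Q \<phi>) y) = array Y y"
    and "x \<in> carrier X \<Longrightarrow> fapp (und (larr Q \<phi>) y) x = und \<phi> (x, y)"
  using assms by (auto simp: larr_def Hom_RelQ_iff fapp_fam asets_carrier_small)

lemma larr_Hom: "larr Q \<phi> \<in> Hom (SetQ Q) Y (Psh Q X)" if "\<phi> \<in> Hom (RelQ Q) X Y"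
proof -
  have \<phi>: "X \<in> asets Q" "Y \<in> asets Q" "src \<phi> = X" "tgt \<phi> = Y"
    using that by (simp_all add: Hom_RelQ_iff)
  have mem: "und (larr Q \<phi>) y \<in> carrier (Psh Q X)" if "y \<in> carrier Y" for y
    using that \<open>\<phi> \<in> Hom (RelQ Q) X Y\<close>
    by (auto simp: larr_def Hom_RelQ_iff asets_array intro!: fam_mem_Psh)
  show ?thesis
    unfolding Hom_SetQ_iff
    using mem \<phi> larr_apply(1)[OF that]
    by (auto simp: Psh_in_asets Psh_memD(2) larr_def)
qed

lemma rel_of_Hom: "rel_of X p \<in> Hom (RelQ Q) X Y"
  if "p \<in> Hom (SetQ Q) Y (Psh Q X)" "X \<in> asets Q"
proof -
  have "fapp (und p y) x \<in> Hom Q (array X x) (array Y y)" if "x \<in> carrier X" "y \<in> carrier Y" for x y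
    using that \<open>p \<in> _\<close> \<open>X \<in> asets Q\<close> Psh_memD(2,3)[of "und p y" X]
    by (auto simp: Hom_SetQ_iff PiE_iff)
  then show ?thesis
    using that by (auto simp: Hom_RelQ_iff Hom_SetQ_iff rel_of_def)
qed

lemma larr_rel_of: "larr Q (rel_of X p) = p"
  if p: "p \<in> Hom (SetQ Q) Y (Psh Q X)" and X: "X \<in> asets Q"
proof (rule SetQ_eqI)
  note r = rel_of_Hom[OF p X]
  show l: "larr Q (rel_of X p) \<in> Hom (SetQ Q) Y (Psh Q X)"
    using r by (rule larr_Hom)
  show "p \<in> Hom (SetQ Q) Y (Psh Q X)" by (rule p)
  fix y assume y: "y \<in> carrier Y"
  have mem: "und (larr Q (rel_of X p)) y \<in> carrier (Psh Q X)" "und p y \<in> carrier (Psh Q X)"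
    using l p y by (auto simp: Hom_SetQ_iff PiE_iff)
  show "und (larr Q (rel_of X p)) y = und p y"
  proof (rule Psh_eqI[OF mem X])
    show "fcod (und (larr Q (rel_of X p)) y) = fcod (und p y)"
      using p y mem(2) X larr_apply(1)[OF r y] Psh_memD(2)[OF mem(2) X] by (simp add: Hom_SetQ_iff)
    show "fapp (und (larr Q (rel_of X p)) y) x = fapp (und p y) x" if "x \<in> carrier X" for x
      using larr_apply(2)[OF r y that] p y that by (simp add: rel_of_def Hom_SetQ_iff)
  qed
qed

lemma rel_of_larr: "rel_of X (larr Q \<phi>) = \<phi>" if "\<phi> \<in> Hom (RelQ Q) X Y"
proof (rule RelQ_eqI)
  show "rel_of X (larr Q \<phi>) \<in> Hom (RelQ Q) X Y"
    using that by (intro rel_of_Hom larr_Hom) (auto simp: Hom_RelQ_iff)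
  show "\<phi> \<in> Hom (RelQ Q) X Y" by (rule that)
  fix x y assume "x \<in> carrier X" "y \<in> carrier Y"
  moreover have "src (larr Q \<phi>) = Y"
    using larr_Hom[OF that] by (simp add: Hom_SetQ_iff)
  ultimately show "und (rel_of X (larr Q \<phi>)) (x, y) = und \<phi> (x, y)"
    using larr_apply(2)[OF that] by (simp add: rel_of_def)
qed

lemma map_le_larr_iff: "map_le Q X (larr Q \<phi>) (larr Q \<psi>) \<longleftrightarrow> rel_le Q \<phi> \<psi>"
  if "\<phi> \<in> Hom (RelQ Q) X Y" "\<psi> \<in> Hom (RelQ Q) X Y"
proof -
  have "src (larr Q \<phi>) = Y" "src \<phi> = X" "tgt \<phi> = Y"
    using larr_Hom[OF that(1)] that(1) by (simp_all add: Hom_SetQ_iff Hom_RelQ_iff)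
  then show ?thesis
    by (auto simp: map_le_def Psh_le_def rel_le_def larr_apply[OF that(1)] larr_apply[OF that(2)])
qed

lemma circ_Hom: "circ Q f \<in> Hom (RelQ Q) Y X" if "f \<in> Hom (SetQ Q) X Y"
  using that
  by (auto simp: circ_def Hom_SetQ_iff Hom_RelQ_iff asets_array intro!: bottom_Hom Id_Hom)

lemma rel_comp_terms:
  "{und \<psi> (y, z) \<cdot>\<^bsub>Q\<^esub> und \<phi> (x, y) | y. y \<in> carrier Y} \<subseteq> Hom Q (array X x) (array Z z)"
  if "\<phi> \<in> Hom (RelQ Q) X Y" "\<psi> \<in> Hom (RelQ Q) Y Z" "x \<in> carrier X" "z \<in> carrier Z"
  using that by (force simp: Hom_RelQ_iff intro: Comp_Hom)

lemma rel_comp_Hom: "rel_comp Q \<psi> \<phi> \<in> Hom (RelQ Q) X Z"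
  if "\<phi> \<in> Hom (RelQ Q) X Y" "\<psi> \<in> Hom (RelQ Q) Y Z"
  using that rel_comp_terms[OF that]
  by (auto simp: rel_comp_def Hom_RelQ_iff asets_array intro!: Sup_Hom)

lemma rel_comp_le_iff:
  "qle Q (und (rel_comp Q \<psi> \<phi>) (x, z)) u \<longleftrightarrow>
    (\<forall>y\<in>carrier Y. qle Q (und \<psi> (y, z) \<cdot>\<^bsub>Q\<^esub> und \<phi> (x, y)) u)"
  if "\<phi> \<in> Hom (RelQ Q) X Y" "\<psi> \<in> Hom (RelQ Q) Y Z" "x \<in> carrier X" "z \<in> carrier Z"
    "u \<in> Hom Q (array X x) (array Z z)"
proof -
  have "und (rel_comp Q \<psi> \<phi>) (x, z) = \<Squnion>\<^bsub>lat Q (array X x) (array Z z)\<^esub>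
      {und \<psi> (y, z) \<cdot>\<^bsub>Q\<^esub> und \<phi> (x, y) | y. y \<in> carrier Y}"
    using that(1-4) by (simp add: rel_comp_def Hom_RelQ_iff)
  then show ?thesis
    using Sup_le_iff[OF rel_comp_terms[OF that(1-4)] that(5)] by auto
qed


lemma rel_comp_circ_left: "und (rel_comp Q (circ Q h) \<phi>) (x, z) = und \<phi> (x, und h z)"
  if \<phi>: "\<phi> \<in> Hom (RelQ Q) X Y" and h: "h \<in> Hom (SetQ Q) Z Y" and x: "x \<in> carrier X" and z: "z \<in> carrier Z"
proof (rule hom_eqI)
  note c = circ_Hom[OF h]
  have hz: "und h z \<in> carrier Y" "array Y (und h z) = array Z z"
    using h z by (auto simp: Hom_SetQ_iff)
  show "und (rel_comp Q (circ Q h) \<phi>) (x, z) \<in> Hom Q (array X x) (array Z z)"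
    using rel_comp_Hom[OF \<phi> c] x z by (simp add: Hom_RelQ_iff)
  show in_hom: "und \<phi> (x, und h z) \<in> Hom Q (array X x) (array Z z)"
    using \<phi> hz(1) x unfolding hz(2)[symmetric] by (simp add: Hom_RelQ_iff)
  fix u assume u: "u \<in> Hom Q (array X x) (array Z z)"
  have term_le: "qle Q (und (circ Q h) (y, z) \<cdot>\<^bsub>Q\<^esub> und \<phi> (x, y)) u \<longleftrightarrow>
      (und h z = y \<longrightarrow> qle Q (und \<phi> (x, und h z)) u)" if y: "y \<in> carrier Y" for y
  proof (cases "und h z = y")
    case True
    then show ?thesis
      using h y z hz Id_Comp[OF in_hom] by (simp add: circ_def Hom_SetQ_iff)
  next
    case False
    have "und \<phi> (x, y) \<in> Hom Q (array X x) (array Y y)"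
      using \<phi> x y by (simp add: Hom_RelQ_iff)
    with False show ?thesis
      using h y z bottom_Comp_le[OF _ u] by (simp add: circ_def Hom_SetQ_iff)
  qed
  show "qle Q (und (rel_comp Q (circ Q h) \<phi>) (x, z)) u \<longleftrightarrow> qle Q (und \<phi> (x, und h z)) u"
    using hz by (auto simp: rel_comp_le_iff[OF \<phi> c x z u] term_le)
qed

lemma rel_comp_circ_right_le_iff:
  "qle Q (und (rel_comp Q \<phi> (circ Q f)) (y, z)) u \<longleftrightarrow>
    (\<forall>x\<in>carrier X. und f x = y \<longrightarrow> qle Q (und \<phi> (x, z)) u)"
  if \<phi>: "\<phi> \<in> Hom (RelQ Q) X Z" and f: "f \<in> Hom (SetQ Q) X Y" and y: "y \<in> carrier Y"
    and z: "z \<in> carrier Z" and u: "u \<in> Hom Q (array Y y) (array Z z)"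
proof -
  have "qle Q (und \<phi> (x, z) \<cdot>\<^bsub>Q\<^esub> und (circ Q f) (y, x)) u \<longleftrightarrow>
      (und f x = y \<longrightarrow> qle Q (und \<phi> (x, z)) u)" if x: "x \<in> carrier X" for x
  proof -
    have in_hom: "und \<phi> (x, z) \<in> Hom Q (array X x) (array Z z)"
      using \<phi> x z by (simp add: Hom_RelQ_iff)
    show ?thesis
    proof (cases "und f x = y")
      case True
      then show ?thesis
        using f x y Comp_Id[OF in_hom] by (simp add: circ_def Hom_SetQ_iff)
    next
      case False
      then show ?thesis
        using f x y Comp_bottom_le[OF in_hom u] by (simp add: circ_def Hom_SetQ_iff)
    qed
  qed
  then show ?thesis
    by (simp add: rel_comp_le_iff[OF circ_Hom[OF f] \<phi> y z u])
qed

text \<open>For relations the homomorphism condition says that values increase along the maps. In this form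
  closure under composition is transitivity of the order.\<close>

lemma rel_le_circ_iff:
  "rel_le Q (rel_comp Q \<alpha> (circ Q f)) (rel_comp Q (circ Q g) \<beta>) \<longleftrightarrow>
    (\<forall>x\<in>carrier X. \<forall>t\<in>carrier X'. qle Q (und \<alpha> (x, t)) (und \<beta> (und f x, und g t)))"
  if \<alpha>: "\<alpha> \<in> Hom (RelQ Q) X X'" and \<beta>: "\<beta> \<in> Hom (RelQ Q) Y Y'"
    and f: "f \<in> Hom (SetQ Q) X Y" and g: "g \<in> Hom (SetQ Q) X' Y'"
proof -
  have src_tgt: "src (rel_comp Q \<alpha> (circ Q f)) = Y" "tgt (rel_comp Q \<alpha> (circ Q f)) = X'"
    using rel_comp_Hom[OF circ_Hom[OF f] \<alpha>] by (simp_all add: Hom_RelQ_iff)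
  have "und \<beta> (y, und g t) \<in> Hom Q (array Y y) (array X' t)"
    if "y \<in> carrier Y" "t \<in> carrier X'" for y t
    using \<beta> g that by (force simp: Hom_RelQ_iff Hom_SetQ_iff)
  moreover have "und f x \<in> carrier Y" if "x \<in> carrier X" for x
    using f that by (auto simp: Hom_SetQ_iff)
  ultimately show ?thesis
    by (auto simp: rel_le_def src_tgt rel_comp_circ_left[OF \<beta> g] rel_comp_circ_right_le_iff[OF \<alpha> f])
qed


section \<open>The presheaf monad in terms of relations\<close>

lemma set_comp_Hom: "g \<odot> f \<in> Hom (SetQ Q) X Z"
  if "f \<in> Hom (SetQ Q) X Y" "g \<in> Hom (SetQ Q) Y Z"
  using that by (auto simp: Hom_SetQ_iff set_comp_def compose_eq compose_def) (metis PiE_mem)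

lemma set_comp_assoc: "h \<odot> (g \<odot> f) = h \<odot> g \<odot> f"
  if "f \<in> Hom (SetQ Q) W X" "g \<in> Hom (SetQ Q) X Y" "h \<in> Hom (SetQ Q) Y Z"
  using that by (auto simp: Hom_SetQ_iff set_comp_def compose_def intro!: ext)

lemma Psh_map_terms:
  "{fapp \<sigma> x | x. x \<in> carrier X \<and> und f x = y} \<subseteq> Hom Q (array Y y) (fcod \<sigma>)"
  if "f \<in> Hom (SetQ Q) X Y" "\<sigma> \<in> carrier (Psh Q X)"
  using that Psh_memD(3)[OF that(2)] by (auto simp: Hom_SetQ_iff)

lemma Psh_map_apply:
  assumes f: "f \<in> Hom (SetQ Q) X Y" and \<sigma>: "\<sigma> \<in> carrier (Psh Q X)"
  shows "fcod (und (Psh_map Q f) \<sigma>) = fcod \<sigma>"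
    and "y \<in> carrier Y \<Longrightarrow> fapp (und (Psh_map Q f) \<sigma>) y =
      \<Squnion>\<^bsub>lat Q (array Y y) (fcod \<sigma>)\<^esub> {fapp \<sigma> x | x. x \<in> carrier X \<and> und f x = y}"
  using assms by (auto simp: Psh_map_def Hom_SetQ_iff fapp_fam asets_carrier_small)

lemma Psh_map_Hom: "Psh_map Q f \<in> Hom (SetQ Q) (Psh Q X) (Psh Q Y)" if f: "f \<in> Hom (SetQ Q) X Y"
proof -
  have XY: "X \<in> asets Q" "Y \<in> asets Q" "src f = X" "tgt f = Y"
    using f by (simp_all add: Hom_SetQ_iff)
  have mem: "und (Psh_map Q f) \<sigma> \<in> carrier (Psh Q Y)" if "\<sigma> \<in> carrier (Psh Q X)" for \<sigma>
    using that XY Psh_map_terms[OF f that] Psh_memD(1)[OF that]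
    by (auto simp: Psh_map_def asets_array intro!: fam_mem_Psh Sup_Hom)
  show ?thesis
    unfolding Hom_SetQ_iff
    using mem XY Psh_map_apply(1)[OF f] by (auto simp: Psh_in_asets Psh_memD(2) Psh_map_def)
qed

lemma Psh_mult_terms:
  "{fapp \<Sigma> \<sigma> \<cdot>\<^bsub>Q\<^esub> fapp \<sigma> x | \<sigma>. \<sigma> \<in> carrier (Psh Q X)} \<subseteq> Hom Q (array X x) (fcod \<Sigma>)"
  if "X \<in> asets Q" "\<Sigma> \<in> carrier (Psh Q (Psh Q X))" "x \<in> carrier X"
  using that Psh_memD(2,3)[of _ X] Psh_memD(3)[OF that(2)]
  by (auto simp: Psh_in_asets intro!: Comp_Hom)

lemma Psh_mult_apply:
  assumes "X \<in> asets Q" "\<Sigma> \<in> carrier (Psh Q (Psh Q X))"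
  shows "fcod (und (Psh_mult Q X) \<Sigma>) = fcod \<Sigma>"
    and "x \<in> carrier X \<Longrightarrow> fapp (und (Psh_mult Q X) \<Sigma>) x =
      \<Squnion>\<^bsub>lat Q (array X x) (fcod \<Sigma>)\<^esub> {fapp \<Sigma> \<sigma> \<cdot>\<^bsub>Q\<^esub> fapp \<sigma> x | \<sigma>. \<sigma> \<in> carrier (Psh Q X)}"
  using assms by (auto simp: Psh_mult_def fapp_fam asets_carrier_small)

lemma Psh_mult_Hom: "Psh_mult Q X \<in> Hom (SetQ Q) (Psh Q (Psh Q X)) (Psh Q X)" if X: "X \<in> asets Q"
proof -
  have PX: "Psh Q X \<in> asets Q"
    using X by (rule Psh_in_asets)
  have mem: "und (Psh_mult Q X) \<Sigma> \<in> carrier (Psh Q X)" if "\<Sigma> \<in> carrier (Psh Q (Psh Q X))" for \<Sigma>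
    using that X Psh_mult_terms[OF X that] Psh_memD(1)[OF that PX]
    by (auto simp: Psh_mult_def asets_array intro!: fam_mem_Psh Sup_Hom)
  show ?thesis
    unfolding Hom_SetQ_iff
    using mem X PX Psh_mult_apply(1)[OF X] by (auto simp: Psh_in_asets Psh_memD(2) Psh_mult_def)
qed

text \<open>A map over \<open>Ob Q\<close> determines the codomains of its values, so it is determined by their components.\<close>

lemma larr_eqI: "larr Q \<phi> = p"
  if "\<phi> \<in> Hom (RelQ Q) X Y" "p \<in> Hom (SetQ Q) Y (Psh Q X)"
    "\<And>x y. x \<in> carrier X \<Longrightarrow> y \<in> carrier Y \<Longrightarrow> fapp (und p y) x = und \<phi> (x, y)"
proof -
  have X: "X \<in> asets Q" and "src p = Y"
    using that by (simp_all add: Hom_RelQ_iff Hom_SetQ_iff)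
  have "rel_of X p = \<phi>"
    using rel_of_Hom[OF that(2) X] that(1)
    by (rule RelQ_eqI) (simp add: rel_of_def \<open>src p = Y\<close> that(3))
  then show ?thesis
    using larr_rel_of[OF that(2) X] by simp
qed

lemma larr_Id: "larr Q (Id (RelQ Q) X) = Psh_unit Q X"
  by (auto simp: larr_def Psh_unit_def RelQ_def SetQ_def circ_def restrict_def
      intro!: ext fam_cong)

lemma Id_RelQ_Hom: "Id (RelQ Q) X \<in> Hom (RelQ Q) X X" if "X \<in> asets Q"
  using that circ_Hom[of "Id (SetQ Q) X" X X] by (simp add: RelQ_def Hom_SetQ_iff) (simp add: SetQ_def)

lemma larr_circ_comp: "larr Q (rel_comp Q (circ Q h) \<phi>) = larr Q \<phi> \<odot> h"
  if \<phi>: "\<phi> \<in> Hom (RelQ Q) X Y" and h: "h \<in> Hom (SetQ Q) Z Y"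
proof (rule larr_eqI)
  show "rel_comp Q (circ Q h) \<phi> \<in> Hom (RelQ Q) X Z"
    using \<phi> circ_Hom[OF h] by (rule rel_comp_Hom)
  show "larr Q \<phi> \<odot> h \<in> Hom (SetQ Q) Z (Psh Q X)"
    using h larr_Hom[OF \<phi>] by (rule set_comp_Hom)
  fix x z assume xz: "x \<in> carrier X" "z \<in> carrier Z"
  then have "und h z \<in> carrier Y" "src h = Z"
    using h by (auto simp: Hom_SetQ_iff)
  with xz show "fapp (und (larr Q \<phi> \<odot> h) z) x = und (rel_comp Q (circ Q h) \<phi>) (x, z)"
    by (simp add: set_comp_apply larr_apply(2)[OF \<phi>] rel_comp_circ_left[OF \<phi> h])
qed

lemma larr_comp_circ: "larr Q (rel_comp Q \<phi> (circ Q f)) = Psh_map Q f \<odot> larr Q \<phi>"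
  if \<phi>: "\<phi> \<in> Hom (RelQ Q) X Z" and f: "f \<in> Hom (SetQ Q) X Y"
proof (rule larr_eqI)
  show c: "rel_comp Q \<phi> (circ Q f) \<in> Hom (RelQ Q) Y Z"
    using circ_Hom[OF f] \<phi> by (rule rel_comp_Hom)
  show p: "Psh_map Q f \<odot> larr Q \<phi> \<in> Hom (SetQ Q) Z (Psh Q Y)"
    using larr_Hom[OF \<phi>] Psh_map_Hom[OF f] by (rule set_comp_Hom)
  fix y z assume y: "y \<in> carrier Y" and z: "z \<in> carrier Z"
  have \<sigma>: "und (larr Q \<phi>) z \<in> carrier (Psh Q X)" "src (larr Q \<phi>) = Z"
    using larr_Hom[OF \<phi>] z by (auto simp: Hom_SetQ_iff)
  have value_eq: "fapp (und (Psh_map Q f \<odot> larr Q \<phi>) z) y =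
      \<Squnion>\<^bsub>lat Q (array Y y) (array Z z)\<^esub> {fapp (und (larr Q \<phi>) z) x | x. x \<in> carrier X \<and> und f x = y}"
    using \<sigma> y z Psh_map_apply(2)[OF f \<sigma>(1) y] by (simp add: set_comp_apply larr_apply(1)[OF \<phi> z])
  have terms: "{fapp (und (larr Q \<phi>) z) x | x. x \<in> carrier X \<and> und f x = y} \<subseteq> Hom Q (array Y y) (array Z z)"
    using Psh_map_terms[OF f \<sigma>(1)] by (simp add: larr_apply(1)[OF \<phi> z])
  show "fapp (und (Psh_map Q f \<odot> larr Q \<phi>) z) y = und (rel_comp Q \<phi> (circ Q f)) (y, z)"
  proof (rule hom_eqI)
    show in_hom: "und (rel_comp Q \<phi> (circ Q f)) (y, z) \<in> Hom Q (array Y y) (array Z z)"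
      using c y z by (simp add: Hom_RelQ_iff)
    show "fapp (und (Psh_map Q f \<odot> larr Q \<phi>) z) y \<in> Hom Q (array Y y) (array Z z)"
      using Hom_Ob[OF in_hom] terms by (auto simp: value_eq intro!: Sup_Hom)
    show "qle Q (fapp (und (Psh_map Q f \<odot> larr Q \<phi>) z) y) u \<longleftrightarrow>
        qle Q (und (rel_comp Q \<phi> (circ Q f)) (y, z)) u"
      if u: "u \<in> Hom Q (array Y y) (array Z z)" for u
      by (auto simp: value_eq Sup_le_iff[OF terms u] rel_comp_circ_right_le_iff[OF \<phi> f y z u]
          larr_apply(2)[OF \<phi> z])
  qed
qed

text \<open>Composition of relations is Kleisli composition for the presheaf monad. The pushforward along
  \<open>larr Q \<phi>\<close> groups the indices \<open>y\<close> by the presheaf \<open>\<phi>(-, y)\<close>, so the double supremum on the right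
  runs over every \<open>y\<close> exactly once.\<close>

lemma larr_rel_comp:
  "larr Q (rel_comp Q \<psi> \<phi>) = Psh_mult Q X \<odot> Psh_map Q (larr Q \<phi>) \<odot> larr Q \<psi>"
  if \<phi>: "\<phi> \<in> Hom (RelQ Q) X Y" and \<psi>: "\<psi> \<in> Hom (RelQ Q) Y Z"
proof (rule larr_eqI)
  note L\<phi> = larr_Hom[OF \<phi>] and L\<psi> = larr_Hom[OF \<psi>]
  have X: "X \<in> asets Q"
    using \<phi> by (simp add: Hom_RelQ_iff)
  show c: "rel_comp Q \<psi> \<phi> \<in> Hom (RelQ Q) X Z"
    using \<phi> \<psi> by (rule rel_comp_Hom)
  let ?p = "Psh_mult Q X \<odot> Psh_map Q (larr Q \<phi>) \<odot> larr Q \<psi>"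
  show "?p \<in> Hom (SetQ Q) Z (Psh Q X)"
    using L\<psi> set_comp_Hom[OF Psh_map_Hom[OF L\<phi>] Psh_mult_Hom[OF X]] by (rule set_comp_Hom)
  fix x z assume x: "x \<in> carrier X" and z: "z \<in> carrier Z"
  define \<Sigma> where "\<Sigma> = und (Psh_map Q (larr Q \<phi>)) (und (larr Q \<psi>) z)"
  have \<tau>: "und (larr Q \<psi>) z \<in> carrier (Psh Q Y)" "src (larr Q \<psi>) = Z"
    using L\<psi> z by (auto simp: Hom_SetQ_iff)
  have \<Sigma>: "\<Sigma> \<in> carrier (Psh Q (Psh Q X))" "fcod \<Sigma> = array Z z"
    using Psh_map_Hom[OF L\<phi>] \<tau> Psh_map_apply(1)[OF L\<phi> \<tau>(1)] larr_apply(1)[OF \<psi> z]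
    by (auto simp: Hom_SetQ_iff \<Sigma>_def)
  have "src (Psh_map Q (larr Q \<phi>)) = Psh Q Y"
    using Psh_map_Hom[OF L\<phi>] by (simp add: Hom_SetQ_iff)
  then have "und ?p z = und (Psh_mult Q X) \<Sigma>"
    using z \<tau> by (simp add: set_comp_apply \<Sigma>_def)
  then have value_eq: "fapp (und ?p z) x = \<Squnion>\<^bsub>lat Q (array X x) (array Z z)\<^esub>
      {fapp \<Sigma> \<sigma> \<cdot>\<^bsub>Q\<^esub> fapp \<sigma> x | \<sigma>. \<sigma> \<in> carrier (Psh Q X)}"
    using Psh_mult_apply(2)[OF X \<Sigma>(1) x] \<Sigma>(2) by simp
  have terms: "{fapp \<Sigma> \<sigma> \<cdot>\<^bsub>Q\<^esub> fapp \<sigma> x | \<sigma>. \<sigma> \<in> carrier (Psh Q X)} \<subseteq> Hom Q (array X x) (array Z z)"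
    using Psh_mult_terms[OF X \<Sigma>(1) x] \<Sigma>(2) by simp
  show "fapp (und ?p z) x = und (rel_comp Q \<psi> \<phi>) (x, z)"
  proof (rule hom_eqI)
    show in_hom: "und (rel_comp Q \<psi> \<phi>) (x, z) \<in> Hom Q (array X x) (array Z z)"
      using c x z by (simp add: Hom_RelQ_iff)
    show "fapp (und ?p z) x \<in> Hom Q (array X x) (array Z z)"
      using Hom_Ob[OF in_hom] terms by (auto simp: value_eq intro!: Sup_Hom)
    fix u assume u: "u \<in> Hom Q (array X x) (array Z z)"
    have "qle Q (fapp \<Sigma> \<sigma> \<cdot>\<^bsub>Q\<^esub> fapp \<sigma> x) u \<longleftrightarrow> (\<forall>y\<in>carrier Y. und (larr Q \<phi>) y = \<sigma> \<longrightarrow>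
        qle Q (und \<psi> (y, z) \<cdot>\<^bsub>Q\<^esub> und \<phi> (x, y)) u)" if \<sigma>: "\<sigma> \<in> carrier (Psh Q X)" for \<sigma>
    proof -
      have s: "array (Psh Q X) \<sigma> = fcod \<sigma>" "fapp \<sigma> x \<in> Hom Q (array X x) (fcod \<sigma>)"
        using Psh_memD(2,3)[OF \<sigma> X] x by simp_all
      have "fapp \<Sigma> \<sigma> = \<Squnion>\<^bsub>lat Q (fcod \<sigma>) (array Z z)\<^esub>
          {fapp (und (larr Q \<psi>) z) y | y. y \<in> carrier Y \<and> und (larr Q \<phi>) y = \<sigma>}"
        using Psh_map_apply(2)[OF L\<phi> \<tau>(1) \<sigma>] s(1) larr_apply(1)[OF \<psi> z] by (simp add: \<Sigma>_def)
      moreover have "{fapp (und (larr Q \<psi>) z) y | y. y \<in> carrier Y \<and> und (larr Q \<phi>) y = \<sigma>}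
          \<subseteq> Hom Q (fcod \<sigma>) (array Z z)"
        using Psh_map_terms[OF L\<phi> \<tau>(1), of \<sigma>] s(1) larr_apply(1)[OF \<psi> z] by simp
      ultimately have "qle Q (fapp \<Sigma> \<sigma> \<cdot>\<^bsub>Q\<^esub> fapp \<sigma> x) u \<longleftrightarrow>
          (\<forall>g\<in>{fapp (und (larr Q \<psi>) z) y | y. y \<in> carrier Y \<and> und (larr Q \<phi>) y = \<sigma>}.
            qle Q (g \<cdot>\<^bsub>Q\<^esub> fapp \<sigma> x) u)"
        using Comp_Sup_left_le_iff[OF s(2) _ u] by simp
      then show ?thesis
        using larr_apply(2)[OF \<psi> z] larr_apply(2)[OF \<phi> _ x] by auto
    qed
    moreover have "und (larr Q \<phi>) y \<in> carrier (Psh Q X)" if "y \<in> carrier Y" for y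
      using L\<phi> that by (auto simp: Hom_SetQ_iff)
    ultimately show "qle Q (fapp (und ?p z) x) u \<longleftrightarrow> qle Q (und (rel_comp Q \<psi> \<phi>) (x, z)) u"
      by (auto simp: value_eq Sup_le_iff[OF terms u] rel_comp_le_iff[OF \<phi> \<psi> x z u])
  qed
qed

lemma eps_Hom: "eps Q X \<in> Hom (RelQ Q) X (Psh Q X)" if "X \<in> asets Q"
  using that by (auto simp: eps_def Hom_RelQ_iff Psh_in_asets Psh_memD)

lemma larr_eps: "larr Q (eps Q X) = Id (SetQ Q) (Psh Q X)" if "X \<in> asets Q"
  using eps_Hom[OF that]
proof (rule larr_eqI)
  show "Id (SetQ Q) (Psh Q X) \<in> Hom (SetQ Q) (Psh Q X) (Psh Q X)"
    using Psh_in_asets[OF that] by (auto simp: Hom_SetQ_iff) (auto simp: SetQ_def)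
qed (simp add: SetQ_def eps_def)

text \<open>The universal relation \<open>eps Q X\<close> plays the role of the universal element in the Yoneda lemma.\<close>

lemma circ_larr_eps: "rel_comp Q (circ Q (larr Q \<phi>)) (eps Q X) = \<phi>" if \<phi>: "\<phi> \<in> Hom (RelQ Q) X Y"
proof (rule RelQ_eqI)
  have X: "X \<in> asets Q" using \<phi> by (simp add: Hom_RelQ_iff)
  note e = eps_Hom[OF X] and l = larr_Hom[OF \<phi>]
  show "rel_comp Q (circ Q (larr Q \<phi>)) (eps Q X) \<in> Hom (RelQ Q) X Y"
    using e circ_Hom[OF l] by (rule rel_comp_Hom)
  show "\<phi> \<in> Hom (RelQ Q) X Y" by (rule \<phi>)
  fix x y assume xy: "x \<in> carrier X" "y \<in> carrier Y"
  then have "und (larr Q \<phi>) y \<in> carrier (Psh Q X)"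
    using l by (auto simp: Hom_SetQ_iff)
  then show "und (rel_comp Q (circ Q (larr Q \<phi>)) (eps Q X)) (x, y) = und \<phi> (x, y)"
    using xy larr_apply(2)[OF \<phi>] by (simp add: rel_comp_circ_left[OF e l]) (simp add: eps_def)
qed

end


section \<open>Categories of structured objects\<close>

text \<open>Objects of a category with extra structure, where the admissible arrows between structures
  are singled out by a predicate. Both categories of lax algebras have this form.\<close>

definition structured :: "('o, 'a, 'm) cat_data_scheme \<Rightarrow> 's set \<Rightarrow> ('s \<Rightarrow> 'o) \<Rightarrow>
    ('s \<Rightarrow> 's \<Rightarrow> 'a \<Rightarrow> bool) \<Rightarrow> ('s, ('s, 'a) arr) cat_data"
  where "structured C S U P = \<lparr>
    Ob = S,
    Hom = \<lambda>A B. {Arr A B f | f. A \<in> S \<and> B \<in> S \<and> f \<in> Hom C (U A) (U B) \<and> P A B f},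
    Id = \<lambda>A. Arr A A (Id C (U A)),
    Comp = \<lambda>g f. Arr (src f) (tgt g) (und g \<cdot>\<^bsub>C\<^esub> und f)\<rparr>"

lemma category_structured: "category (structured C S U P)"
  if "category C" "\<And>A. A \<in> S \<Longrightarrow> U A \<in> Ob C" "\<And>A. A \<in> S \<Longrightarrow> P A A (Id C (U A))"
    "\<And>A B D f g. A \<in> S \<Longrightarrow> B \<in> S \<Longrightarrow> D \<in> S \<Longrightarrow>
      f \<in> Hom C (U A) (U B) \<Longrightarrow> g \<in> Hom C (U B) (U D) \<Longrightarrow> P A B f \<Longrightarrow> P B D g \<Longrightarrow> P A D (g \<cdot>\<^bsub>C\<^esub> f)"
proof -
  interpret category C by (rule that(1))
  show ?thesis
    by unfold_locales
      (auto simp: structured_def Id_Comp Comp_Id Comp_assoc intro: that(2-4) Id_Hom Comp_Hom)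
qed

definition restructure :: "('s \<Rightarrow> 't) \<Rightarrow> ('s, ('s, 'a) arr, 't, ('t, 'a) arr) functor_data"
  where "restructure G = \<lparr>omap = G, amap = \<lambda>f. Arr (G (src f)) (G (tgt f)) (und f)\<rparr>"

lemma cat_functor_restructure: "cat_functor (structured C S U P) (structured C S' U' P') (restructure G)"
  if "category (structured C S U P)" "category (structured C S' U' P')"
    "\<And>A. A \<in> S \<Longrightarrow> G A \<in> S'" "\<And>A. A \<in> S \<Longrightarrow> U' (G A) = U A"
    "\<And>A B f. A \<in> S \<Longrightarrow> B \<in> S \<Longrightarrow> f \<in> Hom C (U A) (U B) \<Longrightarrow> P A B f \<Longrightarrow> P' (G A) (G B) f"
  by (intro cat_functor.intro cat_functor_axioms.intro that(1,2))
    (auto simp: structured_def restructure_def that(3-5))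

text \<open>Closure under identities and composition is transported backwards along the equivalence of the
  two predicates. The primed side will be the relational one, where closure is an elementwise
  estimate; a direct proof for lax algebras would go through the functoriality of \<open>Psh_map\<close>.\<close>

lemma cat_isomorphism_restructure:
  "cat_isomorphism (structured C S U P) (structured C S' U' P') (restructure G)"
  if C: "category C" and U': "\<And>A. A \<in> S' \<Longrightarrow> U' A \<in> Ob C"
    and P'_Id: "\<And>A. A \<in> S' \<Longrightarrow> P' A A (Id C (U' A))"
    and P'_Comp: "\<And>A B D f g. A \<in> S' \<Longrightarrow> B \<in> S' \<Longrightarrow> D \<in> S' \<Longrightarrow>
      f \<in> Hom C (U' A) (U' B) \<Longrightarrow> g \<in> Hom C (U' B) (U' D) \<Longrightarrow> P' A B f \<Longrightarrow> P' B D g \<Longrightarrow>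
      P' A D (g \<cdot>\<^bsub>C\<^esub> f)"
    and G: "bij_betw G S S'" and U: "\<And>A. A \<in> S \<Longrightarrow> U' (G A) = U A"
    and P: "\<And>A B f. A \<in> S \<Longrightarrow> B \<in> S \<Longrightarrow> f \<in> Hom C (U A) (U B) \<Longrightarrow> P A B f \<longleftrightarrow> P' (G A) (G B) f"
proof -
  define H where "H = inv_into S G"
  have GS: "G A \<in> S'" "H (G A) = A" if "A \<in> S" for A
    using that G by (auto simp: H_def bij_betw_def)
  have HS: "H A \<in> S" "G (H A) = A" if "A \<in> S'" for A
    using that G by (auto simp: H_def bij_betw_def f_inv_into_f inv_into_into)
  have UH: "U (H A) = U' A" if "A \<in> S'" for A
    using that HS U by metis
  have D': "category (structured C S' U' P')"
    using C U' P'_Id P'_Comp by (rule category_structured)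
  interpret category C by (rule C)
  have D: "category (structured C S U P)"
  proof (rule category_structured[OF C])
    show UA: "U A \<in> Ob C" if "A \<in> S" for A
      using that GS U U' by metis
    show "P A A (Id C (U A))" if "A \<in> S" for A
      using that P[OF that that Id_Hom[OF UA[OF that]]] P'_Id GS U by metis
    fix A B E f g
    assume S: "A \<in> S" "B \<in> S" "E \<in> S"
      and fg: "f \<in> Hom C (U A) (U B)" "g \<in> Hom C (U B) (U E)" "P A B f" "P B E g"
    have "P' (G A) (G E) (g \<cdot>\<^bsub>C\<^esub> f)"
      using S fg by (intro P'_Comp[of _ "G B"]) (simp_all add: GS U flip: P)
    then show "P A E (g \<cdot>\<^bsub>C\<^esub> f)"
      using S fg Comp_Hom by (simp add: P)
  qed
  have "cat_functor (structured C S U P) (structured C S' U' P') (restructure G)"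
    using D D' by (rule cat_functor_restructure) (simp_all add: GS U P)
  moreover have "cat_functor (structured C S' U' P') (structured C S U P) (restructure H)"
    using D' D by (rule cat_functor_restructure) (simp_all add: HS UH P)
  ultimately show ?thesis
    unfolding cat_isomorphism_def
    by (intro conjI exI[of _ "restructure H"])
      (auto simp: functor_eq_def functor_comp_def functor_id_def restructure_def structured_def GS HS)
qed


section \<open>The isomorphism\<close>

locale law_and_extension = small_quantaloid Q + M: cat_monad "SetQ Q" T +
    L: monotone_dist_law Q T lam + H: lax_extension Q T That
  for Q :: "'v::set_universe qtld" and T :: "'v amonad"
    and lam :: "'v aset \<Rightarrow> 'v smap" and That :: "'v qrel \<Rightarrow> 'v qrel"
begin

text \<open>Evaluating the relation between \<open>lam\<close> and \<open>That\<close> at \<open>eps Q X\<close>, whose map is the identity,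
  gives \<open>lam X\<close>. Conversely every relation is \<open>eps Q X\<close> restricted along its own map, and lax
  extensions commute with such restrictions.\<close>

lemma related_iff_eps:
  "(\<forall>X Y. \<forall>\<phi>\<in>Hom (RelQ Q) X Y. larr Q (That \<phi>) = lam X \<odot> amap T (larr Q \<phi>)) \<longleftrightarrow>
    (\<forall>X\<in>Ob (SetQ Q). lam X = larr Q (That (eps Q X)))"
proof (intro iffI allI ballI)
  fix X
  assume "\<forall>X Y. \<forall>\<phi>\<in>Hom (RelQ Q) X Y. larr Q (That \<phi>) = lam X \<odot> amap T (larr Q \<phi>)"
    and "X \<in> Ob (SetQ Q)"
  then have "larr Q (That (eps Q X)) = lam X \<odot> Id (SetQ Q) (omap T (Psh Q X))"
    using eps_Hom[of X] M.amap_Id[of "Psh Q X"] by (auto simp: larr_eps Psh_in_asets)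
  also have "\<dots> = lam X"
    using M.C.Comp_Id[OF L.lam_Hom] \<open>X \<in> Ob (SetQ Q)\<close> by simp
  finally show "lam X = larr Q (That (eps Q X))" ..
next
  fix X Y \<phi>
  assume eps: "\<forall>X\<in>Ob (SetQ Q). lam X = larr Q (That (eps Q X))" and \<phi>: "\<phi> \<in> Hom (RelQ Q) X Y"
  then have X: "X \<in> asets Q"
    by (simp add: Hom_RelQ_iff)
  note e = eps_Hom[OF X] and L\<phi> = larr_Hom[OF \<phi>]
  have "That \<phi> = rel_comp Q (circ Q (amap T (larr Q \<phi>))) (That (eps Q X))"
    using H.That_circ[OF e L\<phi>] by (simp add: circ_larr_eps[OF \<phi>])
  then show "larr Q (That \<phi>) = lam X \<odot> amap T (larr Q \<phi>)"
    using eps X larr_circ_comp[OF H.That_Hom[OF e] M.amap_Hom[OF L\<phi>]] by simp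
qed

end

locale related_extension = law_and_extension Q T lam That
  for Q :: "'v::set_universe qtld" and T :: "'v amonad"
    and lam :: "'v aset \<Rightarrow> 'v smap" and That :: "'v qrel \<Rightarrow> 'v qrel" +
  assumes related: "\<phi> \<in> Hom (RelQ Q) X Y \<Longrightarrow> larr Q (That \<phi>) = lam X \<odot> amap T (larr Q \<phi>)"
begin

text \<open>Each axiom of a lax algebra is the image under \<open>larr Q\<close> of the corresponding axiom of a
  relational category; only the multiplication axiom involves the relation between \<open>lam\<close> and
  \<open>That\<close>.\<close>

lemma lax_algebra_larr_iff:
  "(X, larr Q \<alpha>) \<in> lax_algebras Q T lam \<longleftrightarrow> (X, \<alpha>) \<in> rel_categories Q T That"
  if \<alpha>: "\<alpha> \<in> Hom (RelQ Q) X (omap T X)"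
proof -
  have X: "X \<in> asets Q"
    using \<alpha> by (simp add: Hom_RelQ_iff)
  note e = M.unt_Hom[of X] and m = M.mul_Hom[of X] and L = larr_Hom[OF \<alpha>]
  note TA = H.That_Hom[OF \<alpha>]
  have "larr Q (rel_comp Q (That \<alpha>) \<alpha>) =
      Psh_mult Q X \<odot> Psh_map Q (larr Q \<alpha>) \<odot> (lam X \<odot> amap T (larr Q \<alpha>))"
    using larr_rel_comp[OF \<alpha> TA] by (simp add: related[OF \<alpha>])
  also have "\<dots> = Psh_mult Q X \<odot> Psh_map Q (larr Q \<alpha>) \<odot> lam X \<odot> amap T (larr Q \<alpha>)"
    using set_comp_assoc[OF M.amap_Hom[OF L] L.lam_Hom
        set_comp_Hom[OF Psh_map_Hom[OF L] Psh_mult_Hom[OF X]]] X by simp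
  finally have mult: "larr Q (rel_comp Q (That \<alpha>) \<alpha>) = \<dots>" .
  show ?thesis
    using X \<alpha> L e m
    by (simp add: lax_algebras_def rel_categories_def mult[symmetric] larr_Id[symmetric]
        larr_circ_comp[OF \<alpha>, symmetric] map_le_larr_iff[OF Id_RelQ_Hom rel_comp_Hom[OF \<alpha> circ_Hom]]
        map_le_larr_iff[OF rel_comp_Hom[OF \<alpha> TA] rel_comp_Hom[OF \<alpha> circ_Hom]])
qed

lemma hom_larr_iff:
  "map_le Q Y (Psh_map Q f \<odot> larr Q \<alpha>) (larr Q \<beta> \<odot> amap T f) \<longleftrightarrow>
    rel_le Q (rel_comp Q \<alpha> (circ Q f)) (rel_comp Q (circ Q (amap T f)) \<beta>)"
  if \<alpha>: "\<alpha> \<in> Hom (RelQ Q) X (omap T X)" and \<beta>: "\<beta> \<in> Hom (RelQ Q) Y (omap T Y)"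
    and f: "f \<in> Hom (SetQ Q) X Y"
  using map_le_larr_iff[OF rel_comp_Hom[OF circ_Hom[OF f] \<alpha>]
      rel_comp_Hom[OF \<beta> circ_Hom[OF M.amap_Hom[OF f]]]]
  by (simp add: larr_comp_circ[OF \<alpha> f] larr_circ_comp[OF \<beta> M.amap_Hom[OF f]])

lemma rel_categories_Hom: "snd A \<in> Hom (RelQ Q) (fst A) (omap T (fst A))"
  if "A \<in> rel_categories Q T That"
  using that by (auto simp: rel_categories_def)

definition alg_to_cat :: "'v alg \<Rightarrow> 'v rcat"
  where "alg_to_cat A = (fst A, rel_of (fst A) (snd A))"

lemma larr_alg_to_cat: "larr Q (snd (alg_to_cat A)) = snd A" if "A \<in> lax_algebras Q T lam"
  using that by (auto simp: alg_to_cat_def lax_algebras_def intro: larr_rel_of)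

lemma bij_alg_to_cat: "bij_betw alg_to_cat (lax_algebras Q T lam) (rel_categories Q T That)"
proof (rule bij_betwI)
  show "alg_to_cat \<in> lax_algebras Q T lam \<rightarrow> rel_categories Q T That"
  proof
    fix A assume A: "A \<in> lax_algebras Q T lam"
    then have "rel_of (fst A) (snd A) \<in> Hom (RelQ Q) (fst A) (omap T (fst A))"
      by (auto simp: lax_algebras_def intro: rel_of_Hom)
    with A larr_alg_to_cat[OF A] show "alg_to_cat A \<in> rel_categories Q T That"
      by (auto simp: alg_to_cat_def simp flip: lax_algebra_larr_iff)
  qed
  show "(\<lambda>B. (fst B, larr Q (snd B))) \<in> rel_categories Q T That \<rightarrow> lax_algebras Q T lam"
    using rel_categories_Hom by (auto simp: lax_algebra_larr_iff)
  show "(fst (alg_to_cat A), larr Q (snd (alg_to_cat A))) = A" if "A \<in> lax_algebras Q T lam" for A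
    using larr_alg_to_cat[OF that] by (simp add: alg_to_cat_def)
  show "alg_to_cat (fst B, larr Q (snd B)) = B" if "B \<in> rel_categories Q T That" for B
    using rel_of_larr[OF rel_categories_Hom[OF that]] by (simp add: alg_to_cat_def)
qed

lemma Alg_structured: "Alg Q T lam = structured (SetQ Q) (lax_algebras Q T lam) fst
    (\<lambda>A B f. map_le Q (fst B) (Psh_map Q f \<odot> snd A) (snd B \<odot> amap T f))"
  by (simp add: Alg_def structured_def)

lemma RCat_structured: "RCat Q T That = structured (SetQ Q) (rel_categories Q T That) fst
    (\<lambda>A B f. rel_le Q (rel_comp Q (snd A) (circ Q f)) (rel_comp Q (circ Q (amap T f)) (snd B)))"
  by (simp add: RCat_def structured_def)

lemma cat_isomorphism_Alg_RCat:
  "cat_isomorphism (Alg Q T lam) (RCat Q T That) (restructure alg_to_cat)"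
  unfolding Alg_structured RCat_structured
proof (rule cat_isomorphism_restructure)
  show "category (SetQ Q)"
    by (rule M.C.category_axioms)
  show "fst A \<in> Ob (SetQ Q)" if "A \<in> rel_categories Q T That" for A
    using that by (auto simp: rel_categories_def)
  then have fst_asets: "fst A \<in> asets Q" if "A \<in> rel_categories Q T That" for A
    using that by simp
  show "rel_le Q (rel_comp Q (snd A) (circ Q (Id (SetQ Q) (fst A))))
      (rel_comp Q (circ Q (amap T (Id (SetQ Q) (fst A)))) (snd A))"
    if A: "A \<in> rel_categories Q T That" for A
  proof -
    note \<alpha> = rel_categories_Hom[OF A]
    have id: "Id (SetQ Q) (fst A) \<in> Hom (SetQ Q) (fst A) (fst A)"
      using fst_asets[OF A] by (simp add: M.C.Id_Hom)
    have "qle Q (und (snd A) (x, t)) (und (snd A) (x, t))"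
      if "x \<in> carrier (fst A)" "t \<in> carrier (omap T (fst A))" for x t
      using that \<alpha> by (intro qle_refl) (auto simp: Hom_RelQ_iff)
    then show ?thesis
      using fst_asets[OF A]
      by (subst rel_le_circ_iff[OF \<alpha> \<alpha> id M.amap_Hom[OF id]]) (simp add: M.amap_Id, simp add: SetQ_def)
  qed
  show "rel_le Q (rel_comp Q (snd A) (circ Q (g \<cdot>\<^bsub>SetQ Q\<^esub> f)))
      (rel_comp Q (circ Q (amap T (g \<cdot>\<^bsub>SetQ Q\<^esub> f))) (snd D))"
    if ABD: "A \<in> rel_categories Q T That" "B \<in> rel_categories Q T That" "D \<in> rel_categories Q T That"
      and f: "f \<in> Hom (SetQ Q) (fst A) (fst B)" and g: "g \<in> Hom (SetQ Q) (fst B) (fst D)"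
      and f_le: "rel_le Q (rel_comp Q (snd A) (circ Q f)) (rel_comp Q (circ Q (amap T f)) (snd B))"
      and g_le: "rel_le Q (rel_comp Q (snd B) (circ Q g)) (rel_comp Q (circ Q (amap T g)) (snd D))"
    for A B D f g
  proof -
    note \<alpha> = rel_categories_Hom[OF ABD(1)] and \<beta> = rel_categories_Hom[OF ABD(2)]
      and \<gamma> = rel_categories_Hom[OF ABD(3)]
    note Tf = M.amap_Hom[OF f] and Tg = M.amap_Hom[OF g]
    have "qle Q (und (snd A) (x, t))
        (und (snd D) (und g (und f x), und (amap T g) (und (amap T f) t)))"
      if x: "x \<in> carrier (fst A)" and t: "t \<in> carrier (omap T (fst A))" for x t
    proof (rule qle_trans)
      have fx: "und f x \<in> carrier (fst B)" "array (fst B) (und f x) = array (fst A) x"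
          "und (amap T f) t \<in> carrier (omap T (fst B))"
          "array (omap T (fst B)) (und (amap T f) t) = array (omap T (fst A)) t"
        using f Tf x t by (auto simp: Hom_SetQ_iff)
      then have gfx: "und g (und f x) \<in> carrier (fst D)"
          "array (fst D) (und g (und f x)) = array (fst A) x"
          "und (amap T g) (und (amap T f) t) \<in> carrier (omap T (fst D))"
          "array (omap T (fst D)) (und (amap T g) (und (amap T f) t)) = array (omap T (fst A)) t"
        using g Tg by (auto simp: Hom_SetQ_iff)
      show "qle Q (und (snd A) (x, t)) (und (snd B) (und f x, und (amap T f) t))"
        using f_le x t by (simp add: rel_le_circ_iff[OF \<alpha> \<beta> f Tf])
      show "qle Q (und (snd B) (und f x, und (amap T f) t))
          (und (snd D) (und g (und f x), und (amap T g) (und (amap T f) t)))"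
        using g_le fx by (simp add: rel_le_circ_iff[OF \<beta> \<gamma> g Tg])
      let ?H = "Hom Q (array (fst A) x) (array (omap T (fst A)) t)"
      show "und (snd A) (x, t) \<in> ?H"
        using \<alpha> x t by (simp add: Hom_RelQ_iff)
      show "und (snd B) (und f x, und (amap T f) t) \<in> ?H"
        unfolding fx(2,4)[symmetric] using \<beta> fx(1,3) by (simp add: Hom_RelQ_iff)
      show "und (snd D) (und g (und f x), und (amap T g) (und (amap T f) t)) \<in> ?H"
        unfolding gfx(2,4)[symmetric] using \<gamma> gfx(1,3) by (simp add: Hom_RelQ_iff)
    qed
    moreover have "und (g \<odot> f) x = und g (und f x)" if "x \<in> carrier (fst A)" for x
      using that f by (simp add: set_comp_apply Hom_SetQ_iff)
    moreover have "und (amap T (g \<odot> f)) t = und (amap T g) (und (amap T f) t)"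
      if "t \<in> carrier (omap T (fst A))" for t
      using that Tf M.amap_Comp[OF f g] by (simp add: set_comp_apply Hom_SetQ_iff)
    ultimately show ?thesis
      using M.amap_Hom[OF set_comp_Hom[OF f g]]
      by (simp add: rel_le_circ_iff[OF \<alpha> \<gamma> set_comp_Hom[OF f g]])
  qed
  show "bij_betw alg_to_cat (lax_algebras Q T lam) (rel_categories Q T That)"
    by (rule bij_alg_to_cat)
  show "fst (alg_to_cat A) = fst A" for A
    by (simp add: alg_to_cat_def)
  show "map_le Q (fst B) (Psh_map Q f \<odot> snd A) (snd B \<odot> amap T f) \<longleftrightarrow>
      rel_le Q (rel_comp Q (snd (alg_to_cat A)) (circ Q f))
        (rel_comp Q (circ Q (amap T f)) (snd (alg_to_cat B)))"
    if A: "A \<in> lax_algebras Q T lam" and B: "B \<in> lax_algebras Q T lam"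
      and f: "f \<in> Hom (SetQ Q) (fst A) (fst B)" for A B f
  proof -
    have "alg_to_cat C \<in> rel_categories Q T That" if "C \<in> lax_algebras Q T lam" for C
      using that bij_betwE[OF bij_alg_to_cat] by blast
    then have "snd (alg_to_cat C) \<in> Hom (RelQ Q) (fst C) (omap T (fst C))"
      if "C \<in> lax_algebras Q T lam" for C
      using that rel_categories_Hom by (fastforce simp: alg_to_cat_def)
    then show ?thesis
      using hom_larr_iff[OF _ _ f, of "snd (alg_to_cat A)" "snd (alg_to_cat B)"] A B
      by (simp add: larr_alg_to_cat)
  qed
qed

end

theorem proposition6p8:
  fixes Q :: "'v::set_universe qtld"
    and T :: "'v amonad"
    and lam :: "'v aset \<Rightarrow> 'v smap"
    and That :: "'v qrel \<Rightarrow> 'v qrel"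
  assumes "small_quantaloid Q"
    and "cat_monad (SetQ Q) T"
    and "monotone_dist_law Q T lam"
    and "lax_extension Q T That"
  defines "related \<equiv> \<forall>X Y. \<forall>\<phi>\<in>Hom (RelQ Q) X Y. larr Q (That \<phi>) = lam X \<odot> amap T (larr Q \<phi>)"
    and "related_eps \<equiv> \<forall>X\<in>Ob (SetQ Q). lam X = larr Q (That (eps Q X))"
  shows "(related \<longleftrightarrow> related_eps) \<and>
    (related \<longrightarrow>
      (\<exists>F. cat_isomorphism (Alg Q T lam) (RCat Q T That) F \<and>
        functor_eq (Alg Q T lam) (functor_comp underlying F) underlying \<and>
        (\<forall>A\<in>Ob (Alg Q T lam). larr Q (snd (omap F A)) = snd A)))"
proof (intro conjI impI)
  interpret law_and_extension Q T lam That
    using assms(1-4) by (intro law_and_extension.intro)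
  show "related \<longleftrightarrow> related_eps"
    unfolding related_def related_eps_def by (rule related_iff_eps)
  assume related
  then interpret related_extension Q T lam That
    by unfold_locales (auto simp: related_def)
  show "\<exists>F. cat_isomorphism (Alg Q T lam) (RCat Q T That) F \<and>
      functor_eq (Alg Q T lam) (functor_comp underlying F) underlying \<and>
      (\<forall>A\<in>Ob (Alg Q T lam). larr Q (snd (omap F A)) = snd A)"
  proof (intro exI conjI)
    show "cat_isomorphism (Alg Q T lam) (RCat Q T That) (restructure alg_to_cat)"
      by (rule cat_isomorphism_Alg_RCat)
    show "functor_eq (Alg Q T lam) (functor_comp underlying (restructure alg_to_cat)) underlying"
      by (simp add: functor_eq_def functor_comp_def underlying_def restructure_def alg_to_cat_def)
    show "\<forall>A\<in>Ob (Alg Q T lam). larr Q (snd (omap (restructure alg_to_cat) A)) = snd A"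
      by (simp add: restructure_def larr_alg_to_cat Alg_def)
  qed
qed

end
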